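(* Let $n\ge 2$, let $E=\{e_1,\dots,e_N\}$, $N>n$, be a finite set of points in an $n$-dimensional affine space $V$, and let $\Sigma$ be the set of $n$-dimensional simplices with vertices in $E$. Let $B\subset\Sigma$ be any set of simplices produced by the inductive algorithm described in the context. Then $B$ is a geometrical basis in $V_\Sigma$ with respect to the system $F$, where $F$ is the family of all sets $$f=\{\sigma\in\Sigma:\ \text{all vertices of }\sigma\text{ belong to }S\},$$ with $S$ ranging over all subsets $S\subseteq E$ consisting of $n+2$ points and containing at least $n+1$ points in general position (i.e. $n+1$ affinely independent points).
   Context: **Simplices, chambers, incidence matrix.** $V$ is a real affine space of dimension $n$; $E\subset V$ is finite (not necessarily in general position); $P=\mathrm{conv}(E)$. $\Sigma$ is the set of all (non-degenerate) $n$-dimensional simplices $\sigma(e_{i_1},\dots,e_{i_{n+1}})$ with vertices in $E$. Let $\tilde\Sigma$ be the union of the boundaries of all $\sigma\in\Sigma$. A chamber is the closure of a connected component of $P\setminus\tilde\Sigma$; $\Gamma$ is the set of chambers. The incidence matrix is $A=(a_{\sigma,\gamma})_{\sigma\in\Sigma,\gamma\in\Gamma}$ with $a_{\sigma,\gamma}=1$ if $\gamma\subset\sigma$ and $0$ otherwise. $V_\Sigma$ is the linear space generated by the rows of $A$ over a field of characteristic $0$; a simplex $\sigma$ is identified with its row. A set of simplices is a basis in $V_\Sigma$ if the corresponding rows form a basis of $V_\Sigma$. **Admissible orderings.** An ordering $x_1,\dots,x_M$ of a finite set $X$ of points in an affine space is called admissible if $\mathrm{conv}(x_1,\dots,x_k)\cap\mathrm{conv}(x_{k+1},\dots,x_M)=\emptyset$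 for all $k=1,\dots,M$ (with the hull of the empty set empty). Such orderings exist for every finite set. **The algorithm (construction of $B$).** It is defined by induction on the dimension $d\ge 2$ of the ambient affine space and is applied to a finite set $X$ of points in that space. Fix any admissible ordering $x_1,\dots,x_M$ of $X$. For each $k$ a set $B_k$ of $d$-dimensional simplices with vertices in $X$ is constructed, and $B=\bigcup_k B_k$. *Case $d=2$.* Consider the distinct rays from $x_k$ through the points $x_i$, $i>k$. (They all lie in an open half-plane bounded by a line through $x_k$.) Two distinct such rays are neighbours if no other such ray lies between them. For each pair of neighbouring rays, let $x_i$ and $x_j$ be the points of $X$ (other than $x_k$) nearest to $x_k$ on the first and on the second ray respectively. $B_k$ is the set of all triangles $\sigma(x_k,x_i,x_j)$ so obtained. *Case $d\ge 3$.* For $k<M$ choose a hyperplane $H_k$ strictly separating $\mathrm{conv}(x_1,\dots,x_k)$ from $\mathrm{conv}(x_{k+1},\dots,x_M)$. Let $X_k\subset H_k$ be the set of (distinct) points of intersection of $H_k$ with the segments $(x_k,x_i)$, $i>k$. For a $(d-1)$-dimensional simplex $\sigma^k=\sigma(y_1,\dots,y_d)$ with vertices in $X_k$, put $\mu(\sigma^k)=\sigma(x_k,z_1,\dots,z_d)$, where $z_l$ is the point of $X\setminus\{x_k\}$ nearest to $x_k$ on the ray from $x_k$ through $y_l$. Apply the algorithm in the $(d-1)$-dimensional space $H_k$ to the set $X_k$ (with any admissible ordering of $X_k$ and any further choices), obtaining a set $\tilde B_k$ of $(d-1)$-dimensional simplices with vertices in $X_k$, and set $B_k=\{\mu(\sigma^k):\sigma^k\in\tilde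 B_k\}$. For $k=M$, $B_M=\emptyset$. The set $B$ of the statement is the output for $X=E$, $d=n$. **Geometrical basis.** Let $B\subset\Sigma$, and let $F$ be a family of subsets of $\Sigma$. An element $\sigma\notin B$ is expressed in one step in terms of $B$ using $F$ if there is $f\in F$ with $\sigma\in f$ and $f\setminus\{\sigma\}\subseteq B$. An element $\sigma\notin B$ can be expressed in $k$ steps in terms of $B$ using $F$ if there is a sequence $\sigma_1,\dots,\sigma_k\in\Sigma$ with $\sigma_k=\sigma$ such that $\sigma_1$ is expressed in one step in terms of $B$, $\sigma_2$ is expressed in one step in terms of $B\cup\{\sigma_1\}$, ..., $\sigma_k$ is expressed in one step in terms of $B\cup\{\sigma_1,\dots,\sigma_{k-1}\}$ (each using $F$). A subset $B\subset\Sigma$ is a geometrical basis in $V_\Sigma$ with respect to $F$ if (1) $B$ is a basis in $V_\Sigma$, and (2) for every $\sigma\in\Sigma$ with $\sigma\notin B$ there is $k$ such that $\sigma$ can be expressed in $k$ steps in terms of $B$ using $F$. *)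

theory Defs
  imports "HOL-Analysis.Analysis" "HOL-Library.Function_Algebras"
begin

section \<open>Simplices, chambers and the incidence matrix\<close>

text \<open>
  The ambient \<open>n\<close>-dimensional affine space is a Euclidean space \<open>'a\<close> with \<open>DIM('a) = n\<close>.  A
  non-degenerate simplex is represented by its vertex set, i.e. by an affinely independent set; the
  simplex as a set of points is the convex hull, which determines the vertices as its extreme points.
\<close>

definition simplices :: "'a::euclidean_space set \<Rightarrow> 'a set set" where
  "simplices E = {\<sigma>. \<sigma> \<subseteq> E \<and> card \<sigma> = DIM('a) + 1 \<and> \<not> affine_dependent \<sigma>}"

definition walls :: "'a::euclidean_space set \<Rightarrow> 'a set" where
  "walls E = (\<Union>\<sigma>\<in>simplices E. frontier (convex hull \<sigma>))"

definition chambers :: "'a::euclidean_space set \<Rightarrow> 'a set set" where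
  "chambers E = closure ` components (convex hull E - walls E)"

definition incidence :: "'a::euclidean_space set \<Rightarrow> 'a set \<Rightarrow> 'k::field_char_0" where
  "incidence \<sigma> \<gamma> = (if \<gamma> \<subseteq> convex hull \<sigma> then 1 else 0)"

text \<open>A row, indexed by the chambers, is extended by zero to all sets of points.\<close>

definition incidence_row ::
    "'a::euclidean_space set \<Rightarrow> 'a set \<Rightarrow> 'a set \<Rightarrow> 'k::field_char_0" where
  "incidence_row E \<sigma> = (\<lambda>\<gamma>. if \<gamma> \<in> chambers E then incidence \<sigma> \<gamma> else 0)"

definition row_scale :: "'k::field \<Rightarrow> ('b \<Rightarrow> 'k) \<Rightarrow> 'b \<Rightarrow> 'k" where
  "row_scale c r = (\<lambda>\<gamma>. c * r \<gamma>)"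

interpretation row_space: vector_space "row_scale :: 'k::field \<Rightarrow> ('b \<Rightarrow> 'k) \<Rightarrow> 'b \<Rightarrow> 'k"
  by unfold_locales (auto simp: row_scale_def fun_eq_iff algebra_simps)

definition V_Sigma :: "'a::euclidean_space set \<Rightarrow> ('a set \<Rightarrow> 'k::field_char_0) set" where
  "V_Sigma E = row_space.span (incidence_row E ` simplices E)"

text \<open>
  The rows of \<open>B\<close> form a basis as a family indexed by \<open>B\<close>, hence the injectivity requirement.  The
  argument of type \<open>'k itself\<close> carries the field of coefficients.
\<close>

definition basis_in_V_Sigma ::
    "'k::field_char_0 itself \<Rightarrow> 'a::euclidean_space set \<Rightarrow> 'a set set \<Rightarrow> bool" where
  "basis_in_V_Sigma K E B \<longleftrightarrow>
     B \<subseteq> simplices E \<and>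
     inj_on (incidence_row E :: 'a set \<Rightarrow> 'a set \<Rightarrow> 'k) B \<and>
     row_space.independent ((incidence_row E :: 'a set \<Rightarrow> 'a set \<Rightarrow> 'k) ` B) \<and>
     row_space.span ((incidence_row E :: 'a set \<Rightarrow> 'a set \<Rightarrow> 'k) ` B) = V_Sigma E"

section \<open>Geometrical bases\<close>

definition expressed_one_step :: "'s set set \<Rightarrow> 's set \<Rightarrow> 's \<Rightarrow> bool" where
  "expressed_one_step F B \<sigma> \<longleftrightarrow> \<sigma> \<notin> B \<and> (\<exists>f\<in>F. \<sigma> \<in> f \<and> f - {\<sigma>} \<subseteq> B)"

definition expressed_in_steps ::
    "'s set \<Rightarrow> 's set set \<Rightarrow> nat \<Rightarrow> 's set \<Rightarrow> 's \<Rightarrow> bool" where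
  "expressed_in_steps Sig F k B \<sigma> \<longleftrightarrow>
     \<sigma> \<notin> B \<and>
     (\<exists>ss. length ss = k \<and> ss \<noteq> [] \<and> set ss \<subseteq> Sig \<and> last ss = \<sigma> \<and>
           (\<forall>i<k. expressed_one_step F (B \<union> set (take i ss)) (ss ! i)))"

definition geometrical_basis ::
    "'k::field_char_0 itself \<Rightarrow> 'a::euclidean_space set \<Rightarrow> 'a set set set \<Rightarrow> 'a set set \<Rightarrow> bool" where
  "geometrical_basis K E F B \<longleftrightarrow>
     B \<subseteq> simplices E \<and>
     basis_in_V_Sigma K E B \<and>
     (\<forall>\<sigma>\<in>simplices E. \<sigma> \<notin> B \<longrightarrow> (\<exists>k. expressed_in_steps (simplices E) F k B \<sigma>))"

definition system_F :: "'a::euclidean_space set \<Rightarrow> 'a set set set" where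
  "system_F E =
     {{\<sigma>\<in>simplices E. \<sigma> \<subseteq> S} | S.
        S \<subseteq> E \<and> card S = DIM('a) + 2 \<and>
        (\<exists>T\<subseteq>S. card T = DIM('a) + 1 \<and> \<not> affine_dependent T)}"

section \<open>The algorithm\<close>

text \<open>Lists are indexed from \<open>0\<close>: the point \<open>x\<^sub>k\<close> of an ordering is \<open>xs ! (k - 1)\<close>.\<close>

definition admissible_ordering :: "'a::euclidean_space set \<Rightarrow> 'a list \<Rightarrow> bool" where
  "admissible_ordering X xs \<longleftrightarrow>
     distinct xs \<and> set xs = X \<and>
     (\<forall>k\<in>{1..length xs}. convex hull set (take k xs) \<inter> convex hull set (drop k xs) = {})"

definition ray :: "'a::euclidean_space \<Rightarrow> 'a \<Rightarrow> 'a set" where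
  "ray x y = {x + t *\<^sub>R (y - x) | t. 0 \<le> t}"

text \<open>
  On a ray from \<open>x\<close> the order by distance from \<open>x\<close> does not depend on the Euclidean structure, and
  the minimiser is unique.
\<close>

definition nearest :: "'a::euclidean_space set \<Rightarrow> 'a \<Rightarrow> 'a set \<Rightarrow> 'a" where
  "nearest X x r = arg_min_on (dist x) ((X - {x}) \<inter> r)"

text \<open>
  For rays from a common origin inside an open half-plane, \<open>r\<close> lies between \<open>r1\<close> and \<open>r2\<close> iff it is
  contained in the angle spanned by them, which is the convex hull of \<open>r1 \<union> r2\<close>.
\<close>

definition neighbouring_rays :: "'a::euclidean_space set set \<Rightarrow> 'a set \<Rightarrow> 'a set \<Rightarrow> bool" where
  "neighbouring_rays R r1 r2 \<longleftrightarrow>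
     r1 \<in> R \<and> r2 \<in> R \<and> r1 \<noteq> r2 \<and>
     \<not> (\<exists>r\<in>R. r \<noteq> r1 \<and> r \<noteq> r2 \<and> r \<subseteq> convex hull (r1 \<union> r2))"

text \<open>In the next three definitions, \<open>x\<close> is the point \<open>x\<^sub>k\<close> and \<open>Y\<close> is the set of the \<open>x\<^sub>i\<close> with
  \<open>i > k\<close>.\<close>

definition planar_triangles ::
    "'a::euclidean_space set \<Rightarrow> 'a \<Rightarrow> 'a set \<Rightarrow> 'a set set" where
  "planar_triangles X x Y =
     {{x, nearest X x r1, nearest X x r2} | r1 r2. neighbouring_rays (ray x ` Y) r1 r2}"

definition section_points :: "'a::euclidean_space set \<Rightarrow> 'a \<Rightarrow> 'a set \<Rightarrow> 'a set" where
  "section_points H x Y = H \<inter> (\<Union>y\<in>Y. open_segment x y)"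

definition lift_simplex :: "'a::euclidean_space set \<Rightarrow> 'a \<Rightarrow> 'a set \<Rightarrow> 'a set" where
  "lift_simplex X x \<tau> = insert x ((\<lambda>y. nearest X x (ray x y)) ` \<tau>)"

definition separating_hyperplane ::
    "'a::euclidean_space set \<Rightarrow> 'a set \<Rightarrow> 'a set \<Rightarrow> 'a set \<Rightarrow> bool" where
  "separating_hyperplane A H S T \<longleftrightarrow>
     aff_dim H = aff_dim A - 1 \<and>
     (\<exists>a b. H = {x\<in>A. a \<bullet> x = b} \<and> (\<forall>x\<in>S. a \<bullet> x < b) \<and> (\<forall>x\<in>T. b < a \<bullet> x))"

text \<open>
  \<open>algorithm_output A X B\<close>: for some choice of the admissible orderings and of the hyperplanes at all
  levels of the recursion, the algorithm in the affine space \<open>A\<close> applied to \<open>X\<close> returns \<open>B\<close>.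
\<close>

inductive algorithm_output ::
    "'a::euclidean_space set \<Rightarrow> 'a set \<Rightarrow> 'a set set \<Rightarrow> bool" where
  plane: "algorithm_output A X
      (\<Union>k<length xs. planar_triangles X (xs ! k) (set (drop (Suc k) xs)))"
    if "affine A" "aff_dim A = 2" "finite X" "X \<subseteq> A" "admissible_ordering X xs"
| higher: "algorithm_output A X
      (\<Union>k\<in>{k. Suc k < length xs}. lift_simplex X (xs ! k) ` B' k)"
    if "affine A" "aff_dim A \<ge> 3" "finite X" "X \<subseteq> A" "admissible_ordering X xs"
      "\<forall>k. Suc k < length xs \<longrightarrow>
         separating_hyperplane A (H k)
           (convex hull set (take (Suc k) xs)) (convex hull set (drop (Suc k) xs))"
      "\<forall>k. Suc k < length xs \<longrightarrow>
         algorithm_output (H k) (section_points (H k) (xs ! k) (set (drop (Suc k) xs))) (B' k)"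

end

theory Submission
  imports Defs
begin

text \<open>
  Both halves go by induction along the recursion of the algorithm, with dimension one (consecutive
  pairs of points on a line) as an implicit base case: the plane case is the general step applied to it.

  Close to the point \<open>x\<^sub>k\<close>, a simplex with apex \<open>x\<^sub>k\<close> looks like the cone over its section by \<open>H\<^sub>k\<close>, and
  simplices built at later points are not visible at all.  Hence a relation between the indicator
  functions of \<open>B\<close> that holds at all generic points induces, for the smallest \<open>k\<close> involved, a relation
  between the sections, which is trivial by induction.

  For expressibility, every set of simplices that contains \<open>B\<close> and is closed under one-step expression
  contains, by descending induction on \<open>k\<close>, all simplices on \<open>x\<^sub>k, \<dots>, x\<^sub>M\<close>: steps in \<open>H\<^sub>k\<close> lift to steps on
  the cones, and a vertex can be moved along its ray, because three collinear points \<open>x\<^sub>k, z, w\<close> leave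
  only two simplices with apex \<open>x\<^sub>k\<close> in the corresponding member of \<open>F\<close>.

  Finally, the \<open>n + 2\<close> points of a member of \<open>F\<close> satisfy an affine dependence, unique up to scaling.  A
  generic point of their hull lies in exactly one simplex omitting a point with positive coefficient
  and in exactly one omitting a point with negative coefficient.  This linear relation between the
  rows has coefficients \<open>1\<close> and \<open>-1\<close>, so the span of the rows of \<open>B\<close> is closed under one-step expression.
\<close>

section \<open>Invariants carried along the recursion\<close>

definition full_simplices :: "nat \<Rightarrow> 'a::euclidean_space set \<Rightarrow> 'a set set" where
  "full_simplices d X = {\<sigma>. \<sigma> \<subseteq> X \<and> card \<sigma> = Suc d \<and> \<not> affine_dependent \<sigma>}"

text \<open>One-step expression relative to \<open>F\<close>, rephrased as a closure property that
  makes sense in every dimension \<open>d\<close>. The simplex \<open>\<tau>\<close> itself supplies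
  the affinely independent points required in a member of \<open>F\<close>.\<close>

definition exchange_closed :: "nat \<Rightarrow> 'a::euclidean_space set \<Rightarrow> 'a set set \<Rightarrow> bool" where
  "exchange_closed d X D \<longleftrightarrow>
     (\<forall>S \<tau>. S \<subseteq> X \<longrightarrow> card S = d + 2 \<longrightarrow> \<tau> \<in> full_simplices d S \<longrightarrow>
        full_simplices d S - {\<tau>} \<subseteq> D \<longrightarrow> \<tau> \<in> D)"

text \<open>Expressibility in finitely many steps without mention of sequences: the least
  exchange-closed superset of \<open>B\<close> contains every simplex.\<close>

definition generates :: "nat \<Rightarrow> 'a::euclidean_space set \<Rightarrow> 'a set set \<Rightarrow> bool" where
  "generates d X B \<longleftrightarrow>
     (\<forall>D. B \<subseteq> D \<longrightarrow> exchange_closed d X D \<longrightarrow> full_simplices d X \<subseteq> D)"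

text \<open>Generic points of \<open>A\<close> are those outside an arbitrary finite family of affine sets, none of which
  contains \<open>A\<close>.\<close>

definition generically_independent ::
    "'k::field_char_0 itself \<Rightarrow> 'a::euclidean_space set \<Rightarrow> 'a set set \<Rightarrow> bool" where
  "generically_independent K A B \<longleftrightarrow>
     (\<forall>(\<beta> :: 'a set \<Rightarrow> 'k) \<F>. finite \<F> \<longrightarrow> (\<forall>F\<in>\<F>. affine F \<and> \<not> A \<subseteq> F) \<longrightarrow>
        (\<forall>p\<in>A - \<Union>\<F>. (\<Sum>\<sigma>\<in>B. \<beta> \<sigma> * of_bool (p \<in> convex hull \<sigma>)) = 0) \<longrightarrow>
        (\<forall>\<sigma>\<in>B. \<beta> \<sigma> = 0))"

lemma exchange_closedD:
  assumes "exchange_closed d X D" "S \<subseteq> X" "card S = d + 2" "\<tau> \<in> full_simplices d S"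
    "\<And>\<rho>. \<rho> \<in> full_simplices d S \<Longrightarrow> \<rho> \<noteq> \<tau> \<Longrightarrow> \<rho> \<in> D"
  shows "\<tau> \<in> D"
  using assms unfolding exchange_closed_def by blast

lemma generically_independentD:
  fixes \<beta> :: "'a::euclidean_space set \<Rightarrow> 'k::field_char_0"
  assumes "generically_independent TYPE('k) A B" "finite \<F>"
    and "\<And>F. F \<in> \<F> \<Longrightarrow> affine F \<and> \<not> A \<subseteq> F"
    and "\<And>p. p \<in> A \<Longrightarrow> p \<notin> \<Union>\<F> \<Longrightarrow> (\<Sum>\<sigma>\<in>B. \<beta> \<sigma> * of_bool (p \<in> convex hull \<sigma>)) = 0"
    and "\<sigma> \<in> B"
  shows "\<beta> \<sigma> = 0"
proof -
  have "\<forall>p\<in>A - \<Union>\<F>. (\<Sum>\<sigma>\<in>B. \<beta> \<sigma> * of_bool (p \<in> convex hull \<sigma>)) = 0"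
    using assms(4) by blast
  then show ?thesis using assms unfolding generically_independent_def by blast
qed

lemma full_simplices_mono: "X \<subseteq> Y \<Longrightarrow> full_simplices d X \<subseteq> full_simplices d Y"
  by (auto simp: full_simplices_def)

lemma finite_full_simplices: "finite X \<Longrightarrow> finite (full_simplices d X)"
  by (rule finite_subset[of _ "Pow X"]) (auto simp: full_simplices_def)

section \<open>Scaling along rays\<close>

lemma ray_scale:
  assumes "0 < c"
  shows "ray x (x + c *\<^sub>R (v - x)) = ray x v"
proof -
  have "\<exists>s\<ge>0. x + t *\<^sub>R (c *\<^sub>R (v - x)) = x + s *\<^sub>R (v - x)" if "0 \<le> t" for t
    using that assms by (intro exI[of _ "t * c"]) auto
  moreover have "\<exists>s\<ge>0. x + t *\<^sub>R (v - x) = x + s *\<^sub>R (c *\<^sub>R (v - x))" if "0 \<le> t" for t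
    using that assms by (intro exI[of _ "t / c"]) auto
  ultimately show ?thesis
    unfolding ray_def by fastforce
qed

lemma collinear_affine_dependent:
  assumes "{x, x + s *\<^sub>R v, x + t *\<^sub>R v} \<subseteq> S" "x + s *\<^sub>R v \<noteq> x" "x + t *\<^sub>R v \<noteq> x" "s \<noteq> t"
  shows "affine_dependent S"
proof -
  have "v \<noteq> 0" "s \<noteq> 0" "t \<noteq> 0" using assms by auto
  then have ne: "x + s *\<^sub>R v \<noteq> x + t *\<^sub>R v" using assms by auto
  have "x + t *\<^sub>R v = (1 - t / s) *\<^sub>R x + (t / s) *\<^sub>R (x + s *\<^sub>R v)"
    using \<open>s \<noteq> 0\<close> by (simp add: algebra_simps)
  also have "\<dots> \<in> affine hull {x, x + s *\<^sub>R v}"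
    unfolding affine_hull_2 by (rule CollectI, rule exI[of _ "1 - t/s"], rule exI[of _ "t/s"]) simp
  also have "\<dots> \<subseteq> affine hull (S - {x + t *\<^sub>R v})"
    using assms ne by (intro hull_mono) auto
  finally show ?thesis using assms unfolding affine_dependent_def by blast
qed

text \<open>Nonzero factors preserve the span and injectivity preserves the cardinality; a finite
  set is independent iff its cardinality is the dimension of its span. Without injectivity two
  proportional vectors could be merged.\<close>

lemma independent_scaled_iff:
  fixes f :: "'a::euclidean_space \<Rightarrow> 'a"
  assumes "finite T" "\<And>t. t \<in> T \<Longrightarrow> \<exists>c. c \<noteq> 0 \<and> f t = c *\<^sub>R t" "inj_on f T"
  shows "independent (f ` T) \<longleftrightarrow> independent T"
proof -
  have 1: "span (f ` T) = span T"
  proof (rule span_eq[THEN iffD2], intro conjI subsetI)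
    fix v assume "v \<in> f ` T"
    then obtain t where t: "t \<in> T" "v = f t" by auto
    then show "v \<in> span T" using assms(2)[OF t(1)] by (metis span_scale span_base)
  next
    fix t assume t: "t \<in> T"
    then obtain c where c: "c \<noteq> 0" "f t = c *\<^sub>R t" using assms(2) by auto
    then have "t = (1/c) *\<^sub>R f t" by simp
    also have "\<dots> \<in> span (f ` T)" using t by (intro span_scale span_base) auto
    finally show "t \<in> span (f ` T)" .
  qed
  have ind: "independent U \<longleftrightarrow> dim U = card U" if "finite U" for U :: "'a set"
    using that dim_eq_card_independent card_le_dim_spanning[of U U]
    by (metis card_ge_dim_independent dim_eq_card_independent independent_span_bound order_refl span_superset)
  have "card (f ` T) = card T" by (rule card_image[OF assms(3)])
  then show ?thesis
    using 1 assms(1) by (metis dim_span finite_imageI ind)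
qed

section \<open>Radial sections\<close>

text \<open>\<open>N\<close> selects a point of \<open>Y\<close> on every ray from \<open>x\<close> that meets \<open>Y\<close>; that it is the nearest one is
  irrelevant.\<close>

locale radial_section =
  fixes x a :: "'a::euclidean_space" and b :: real and Y :: "'a set" and N :: "'a set \<Rightarrow> 'a"
  assumes finite_Y: "finite Y"
    and x_below: "a \<bullet> x < b"
    and Y_above: "z \<in> Y \<Longrightarrow> b < a \<bullet> z"
    and N_mem: "z \<in> Y \<Longrightarrow> N (ray x z) \<in> Y"
    and N_ray: "z \<in> Y \<Longrightarrow> N (ray x z) \<in> ray x z"
begin

text \<open>The central projection from \<open>x\<close> onto the hyperplane
  \<open>a \<bullet> z = b\<close>.\<close>

definition pr :: "'a \<Rightarrow> 'a" where
  "pr z = x + ((b - a \<bullet> x) / (a \<bullet> z - a \<bullet> x)) *\<^sub>R (z - x)"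

definition lf :: "'a \<Rightarrow> 'a" where
  "lf y = N (ray x y)"

definition lift :: "'a set \<Rightarrow> 'a set" where
  "lift \<tau> = insert x (lf ` \<tau>)"

lemma x_notin_Y: "x \<notin> Y"
  using x_below Y_above by force

lemma pr_coeff_pos: "z \<in> Y \<Longrightarrow> 0 < (b - a \<bullet> x) / (a \<bullet> z - a \<bullet> x)"
  using x_below Y_above[of z] by simp

lemma inner_pr: "z \<in> Y \<Longrightarrow> a \<bullet> pr z = b"
  using x_below Y_above[of z] by (simp add: pr_def inner_simps)

lemma ray_pr: "z \<in> Y \<Longrightarrow> ray x (pr z) = ray x z"
  unfolding pr_def by (rule ray_scale[OF pr_coeff_pos])

lemma lf_mem: "y \<in> pr ` Y \<Longrightarrow> lf y \<in> Y"
  using N_mem by (auto simp: lf_def ray_pr)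

lemma lf_scale:
  assumes "y \<in> pr ` Y"
  shows "\<exists>c>0. lf y = x + c *\<^sub>R (y - x)"
proof -
  have "lf y \<in> ray x y" using assms N_ray by (auto simp: lf_def ray_pr)
  then obtain t where t: "t \<ge> 0" "lf y = x + t *\<^sub>R (y - x)" unfolding ray_def by auto
  moreover have "lf y \<noteq> x" using lf_mem[OF assms] x_notin_Y by auto
  ultimately show ?thesis by (metis add_0_right less_eq_real_def scaleR_zero_left)
qed

text \<open>The factor \<open>c\<close> cancels, so that the projection depends on the ray only;
  this makes \<open>pr\<close> a left inverse of \<open>lf\<close>.\<close>

lemma pr_scale:
  assumes "a \<bullet> y = b" "0 < c"
  shows "pr (x + c *\<^sub>R (y - x)) = y"
proof -
  have "((b - a \<bullet> x) / (c * (b - a \<bullet> x))) = 1 / c"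
    using assms x_below by (simp add: field_simps)
  then show ?thesis using assms by (simp add: pr_def inner_simps)
qed

lemma pr_lf: "y \<in> pr ` Y \<Longrightarrow> pr (lf y) = y"
  using lf_scale[of y] inner_pr pr_scale by auto

lemma inj_lf: "inj_on lf (pr ` Y)"
  by (metis inj_on_def pr_lf)

lemma lf_image_subset:
  assumes "\<tau> \<subseteq> pr ` Y" shows "lf ` \<tau> \<subseteq> Y"
proof
  fix v assume "v \<in> lf ` \<tau>"
  then obtain y where "y \<in> \<tau>" "v = lf y" by auto
  then show "v \<in> Y" using lf_mem[of y] assms by auto
qed

lemma x_notin_lf_image: "\<tau> \<subseteq> pr ` Y \<Longrightarrow> x \<notin> lf ` \<tau>"
  using lf_image_subset x_notin_Y by (metis subsetD)

lemma card_lift: "\<tau> \<subseteq> pr ` Y \<Longrightarrow> card (lift \<tau>) = Suc (card \<tau>)"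
proof -
  assume t: "\<tau> \<subseteq> pr ` Y"
  then have "x \<notin> lf ` \<tau>" by (rule x_notin_lf_image)
  moreover have "finite \<tau>" using t finite_Y finite_surj by blast
  ultimately show ?thesis
    using t card_image[OF inj_on_subset[OF inj_lf t]] by (simp add: lift_def)
qed

lemma x_notin_affine: 
  assumes "\<tau> \<subseteq> pr ` Y" shows "x \<notin> affine hull \<tau>"
proof -
  have "affine hull \<tau> \<subseteq> {z. a \<bullet> z = b}"
    using assms inner_pr by (intro hull_minimal affine_hyperplane) auto
  then show ?thesis using x_below by auto
qed

text \<open>Since \<open>x\<close> lies off the affine hull of \<open>\<tau>\<close>, affine
  dependence of \<open>\<tau>\<close> amounts to linear dependence of the directions from
  \<open>x\<close>. Lifting multiplies these directions by positive factors.\<close>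

lemma affine_dependent_lift:
  assumes "\<tau> \<subseteq> pr ` Y"
  shows "affine_dependent (lift \<tau>) \<longleftrightarrow> affine_dependent \<tau>"
proof -
  have xn: "x \<notin> \<tau>" using x_notin_affine[OF assms] hull_inc by metis
  have xl: "x \<notin> lf ` \<tau>" using x_notin_lf_image[OF assms] .
  have fin: "finite \<tau>" using assms finite_Y finite_surj by blast
  let ?T = "(\<lambda>y. y - x) ` \<tau>"
  let ?f = "\<lambda>v. lf (v + x) - x"
  have "affine_dependent \<tau> \<longleftrightarrow> affine_dependent (insert x \<tau>)"
    using affine_independent_insert[OF _ x_notin_affine[OF assms]] affine_independent_subset by blast
  also have "\<dots> \<longleftrightarrow> dependent ?T"
    using dependent_imp_affine_dependent affine_dependent_iff_dependent[OF xn] by (simp add: image_def)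
  also have "\<dots> \<longleftrightarrow> dependent (?f ` ?T)"
  proof -
    have "inj_on ?f ?T"
      using inj_on_subset[OF inj_lf assms] by (auto simp: inj_on_def)
    moreover have "\<exists>c. c \<noteq> 0 \<and> ?f t = c *\<^sub>R t" if t: "t \<in> ?T" for t
      using t assms lf_scale by (force simp: less_le)
    ultimately show ?thesis using independent_scaled_iff[of ?T ?f] fin by simp
  qed
  also have "?f ` ?T = (\<lambda>y. y - x) ` (lf ` \<tau>)" by (auto simp: image_image)
  also have "dependent \<dots> \<longleftrightarrow> affine_dependent (lift \<tau>)"
    unfolding lift_def using affine_dependent_iff_dependent[OF xl] by (simp add: image_def)
  finally show ?thesis by simp
qed

lemma lift_full_simplices:
  "\<tau> \<subseteq> pr ` Y \<Longrightarrow> lift \<tau> \<in> full_simplices (Suc d) S \<longleftrightarrow> \<tau> \<in> full_simplices d (pr ` Y) \<and> lift \<tau> \<subseteq> S"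
  by (auto simp: full_simplices_def card_lift affine_dependent_lift)

text \<open>Deleting the apex and projecting from it recovers the section.\<close>

lemma inj_lift: "inj_on lift (Pow (pr ` Y))"
proof (rule inj_on_inverseI[where g = "\<lambda>\<sigma>. pr ` (\<sigma> - {x})"])
  fix \<tau> assume "\<tau> \<in> Pow (pr ` Y)"
  then have t: "\<tau> \<subseteq> pr ` Y" by simp
  then have "lift \<tau> - {x} = lf ` \<tau>" using x_notin_lf_image by (simp add: lift_def)
  moreover have "pr ` lf ` \<tau> = \<tau>" using t pr_lf by (force simp: image_image)
  ultimately show "pr ` (lift \<tau> - {x}) = \<tau>" by simp
qed

section \<open>Exchange steps in the cone over a section\<close>

text \<open>The sections whose lift lies in \<open>D\<close> form an exchange-closed set
  \<open>D'\<close>. Indeed a simplex on \<open>lift S\<close> either contains \<open>x\<close>, and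
  is then the lift of a simplex on \<open>S\<close>, or has all its vertices in \<open>Y\<close> and
  is in \<open>D\<close> by assumption.\<close>

lemma lifts_in_exchange_closed:
  assumes gen: "generates d (pr ` Y) B'" and D: "exchange_closed (Suc d) X D"
    and X: "insert x Y \<subseteq> X" and B': "lift ` B' \<subseteq> D" "B' \<subseteq> full_simplices d (pr ` Y)"
    and Y: "full_simplices (Suc d) Y \<subseteq> D" and \<tau>: "\<tau> \<in> full_simplices d (pr ` Y)"
  shows "lift \<tau> \<in> D"
proof -
  define D' where "D' = {\<tau> \<in> full_simplices d (pr ` Y). lift \<tau> \<in> D}"
  have "exchange_closed d (pr ` Y) D'"
    unfolding exchange_closed_def
  proof (intro allI impI)
    fix S \<tau> assume S: "S \<subseteq> pr ` Y" "card S = d + 2" and \<tau>: "\<tau> \<in> full_simplices d S"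
      and others: "full_simplices d S - {\<tau>} \<subseteq> D'"
    have \<tau>S: "\<tau> \<subseteq> S" using \<tau> by (auto simp: full_simplices_def)
    have \<tau>Y: "\<tau> \<in> full_simplices d (pr ` Y)" using \<tau> full_simplices_mono[OF S(1)] by auto
    have "lift \<tau> \<in> D"
    proof (rule exchange_closedD[OF D])
      show "lift S \<subseteq> X" using lf_image_subset[OF S(1)] X by (auto simp: lift_def)
      show "card (lift S) = Suc d + 2" using card_lift S by simp
      show "lift \<tau> \<in> full_simplices (Suc d) (lift S)"
        using \<tau>Y \<tau>S S lift_full_simplices[of \<tau>] by (auto simp: lift_def)
    next
      fix \<rho> assume \<rho>: "\<rho> \<in> full_simplices (Suc d) (lift S)" "\<rho> \<noteq> lift \<tau>"
      show "\<rho> \<in> D"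
      proof (cases "x \<in> \<rho>")
        case False
        then have "\<rho> \<subseteq> lf ` S" using \<rho>(1) by (auto simp: full_simplices_def lift_def)
        then have "\<rho> \<subseteq> Y" using lf_image_subset[OF S(1)] by blast
        then show ?thesis using \<rho> Y by (auto simp: full_simplices_def)
      next
        case True
        define \<rho>' where "\<rho>' = {y \<in> S. lf y \<in> \<rho>}"
        have eq: "\<rho> = lift \<rho>'"
          using True \<rho> by (auto simp: full_simplices_def lift_def \<rho>'_def)
        moreover have "\<rho>' \<subseteq> pr ` Y" using S by (auto simp: \<rho>'_def)
        ultimately have "\<rho>' \<in> full_simplices d (pr ` Y)" using \<rho> lift_full_simplices by simp
        then have "\<rho>' \<in> full_simplices d S" by (auto simp: full_simplices_def \<rho>'_def)
        then have "\<rho>' \<in> D'" using others \<rho> eq by auto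
        then show ?thesis by (simp add: D'_def eq)
      qed
    qed
    then show "\<tau> \<in> D'" using \<tau>Y by (simp add: D'_def)
  qed
  moreover have "B' \<subseteq> D'" using B' by (auto simp: D'_def)
  ultimately show ?thesis using gen \<tau> unfolding generates_def D'_def by blast
qed

text \<open>Induction on the number of vertices that are not the chosen point of their ray. If there
  are none, the simplex is a lift. Otherwise such a vertex \<open>z\<close> is exchanged for the
  chosen point \<open>w\<close> of its ray, among the vertices of \<open>\<tau>\<close> together
  with \<open>w\<close>. As \<open>x\<close>, \<open>z\<close>, \<open>w\<close> are collinear,
  every other simplex on these points that contains \<open>x\<close> has \<open>w\<close> in place
  of \<open>z\<close> and hence fewer wrong vertices.\<close>

lemma insert_in_exchange_closed:
  assumes gen: "generates d (pr ` Y) B'" and D: "exchange_closed (Suc d) X D"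
    and X: "insert x Y \<subseteq> X" and B': "lift ` B' \<subseteq> D" "B' \<subseteq> full_simplices d (pr ` Y)"
    and Y: "full_simplices (Suc d) Y \<subseteq> D"
  shows "full_simplices (Suc d) (insert x Y) \<subseteq> D"
proof
  fix \<tau> assume "\<tau> \<in> full_simplices (Suc d) (insert x Y)"
  then show "\<tau> \<in> D"
  proof (induction "card {z \<in> \<tau> - {x}. N (ray x z) \<noteq> z}" arbitrary: \<tau> rule: less_induct)
    case less
    have \<tau>: "\<tau> \<subseteq> insert x Y" "card \<tau> = Suc (Suc d)" "\<not> affine_dependent \<tau>"
      using less.prems by (auto simp: full_simplices_def)
    then have fin: "finite \<tau>" by (metis card.infinite nat.distinct(1))
    consider "x \<notin> \<tau>" | "x \<in> \<tau>" "\<forall>z\<in>\<tau> - {x}. N (ray x z) = z"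
      | z where "x \<in> \<tau>" "z \<in> \<tau>" "z \<noteq> x" "N (ray x z) \<noteq> z" by blast
    then show ?case
    proof cases
      case 1
      then show ?thesis using less.prems Y by (auto simp: full_simplices_def)
    next
      case 2
      have "lf (pr z) = z" if "z \<in> \<tau> - {x}" for z
        using 2 that \<tau> ray_pr by (auto simp: lf_def)
      then have "lf ` pr ` (\<tau> - {x}) = \<tau> - {x}" by (force simp: image_image)
      then have eq: "\<tau> = lift (pr ` (\<tau> - {x}))" using 2 by (auto simp: lift_def)
      have "pr ` (\<tau> - {x}) \<subseteq> pr ` Y" using \<tau> by auto
      then have "pr ` (\<tau> - {x}) \<in> full_simplices d (pr ` Y)"
        using lift_full_simplices eq less.prems by metis
      from lifts_in_exchange_closed[OF assms this] show ?thesis using eq by simp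
    next
      case 3
      define w where "w = N (ray x z)"
      have zY: "z \<in> Y" using 3 \<tau> by auto
      have w: "w \<in> Y" "w \<in> ray x z" "w \<noteq> z" using N_mem N_ray zY 3 by (auto simp: w_def)
      then obtain t where t: "t \<ge> 0" "w = x + t *\<^sub>R (z - x)" by (auto simp: ray_def)
      have wx: "w \<noteq> x" using w x_notin_Y by auto
      then have t0: "t > 0" using t by (cases "t = 0") auto
      have t1: "t \<noteq> 1" using t w by auto
      have "ray x w = ray x z" using ray_scale[OF t0, of x z] t(2) by simp
      then have Nw: "N (ray x w) = w" by (metis w_def)
      have col: "affine_dependent S" if "{x, z, w} \<subseteq> S" for S
        using collinear_affine_dependent[of x 1 "z - x" t S] that t 3 wx t1 by simp
      have wt: "w \<notin> \<tau>" using col[of \<tau>] 3 \<tau> by auto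
      show ?thesis
      proof (rule exchange_closedD[OF D])
        show "insert w \<tau> \<subseteq> X" using \<tau> w X by auto
        show "card (insert w \<tau>) = Suc d + 2" using \<tau> wt fin by simp
        show "\<tau> \<in> full_simplices (Suc d) (insert w \<tau>)" using \<tau> by (auto simp: full_simplices_def)
      next
        fix \<rho> assume \<rho>: "\<rho> \<in> full_simplices (Suc d) (insert w \<tau>)" "\<rho> \<noteq> \<tau>"
        then have \<rho>': "\<rho> \<subseteq> insert w \<tau>" "card \<rho> = Suc (Suc d)" "\<not> affine_dependent \<rho>"
          by (auto simp: full_simplices_def)
        show "\<rho> \<in> D"
        proof (cases "x \<in> \<rho>")
          case False
          then have "\<rho> \<subseteq> Y" using \<rho>' \<tau> w by auto
          then show ?thesis using \<rho> Y by (auto simp: full_simplices_def)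
        next
          case True
          \<comment> \<open>Without \<open>w\<close>, the simplex \<open>\<rho>\<close> would be a
            subset of \<open>\<tau>\<close> of the same cardinality.\<close>
          have "w \<in> \<rho>"
            using \<rho>' \<rho>(2) \<tau> fin card_subset_eq[of \<tau> \<rho>] by auto
          then have "z \<notin> \<rho>" using col[of \<rho>] True \<rho>' by auto
          then have "{v \<in> \<rho> - {x}. N (ray x v) \<noteq> v} \<subseteq> {v \<in> \<tau> - {x}. N (ray x v) \<noteq> v} - {z}"
            using \<rho>' Nw by auto
          moreover have "z \<in> {v \<in> \<tau> - {x}. N (ray x v) \<noteq> v}" using 3 by auto
          ultimately have "{v \<in> \<rho> - {x}. N (ray x v) \<noteq> v} \<subset> {v \<in> \<tau> - {x}. N (ray x v) \<noteq> v}"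
            by blast
          then have "card {v \<in> \<rho> - {x}. N (ray x v) \<noteq> v} < card {v \<in> \<tau> - {x}. N (ray x v) \<noteq> v}"
            using fin by (intro psubset_card_mono) auto
          moreover have "\<rho> \<in> full_simplices (Suc d) (insert x Y)"
            using \<rho>' \<tau> w by (auto simp: full_simplices_def)
          ultimately show ?thesis by (rule less.hyps)
        qed
      qed
    qed
  qed
qed

section \<open>The germ of a lifted simplex at its apex\<close>

text \<open>Near the apex a lifted simplex coincides with the cone over its section, whichever
  points were chosen on the rays: it suffices that \<open>e\<close> is smaller than all factors by
  which the vertices of \<open>\<tau>\<close> are moved. Stating this as an eventuality allows
  finitely many such conditions to be met by one \<open>e\<close>.\<close>

lemma eventually_lift_hull:
  assumes \<tau>: "\<tau> \<subseteq> pr ` Y" and q: "a \<bullet> q = b"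
  shows "eventually (\<lambda>e. x + e *\<^sub>R (q - x) \<in> convex hull (lift \<tau>) \<longleftrightarrow> q \<in> convex hull \<tau>) (at_right 0)"
proof -
  have fin: "finite \<tau>" using assms finite_Y finite_surj by blast
  have "\<forall>y\<in>\<tau>. \<exists>c>0. lf y = x + c *\<^sub>R (y - x)" using \<tau> lf_scale by blast
  then obtain c where c: "\<And>y. y \<in> \<tau> \<Longrightarrow> 0 < c y \<and> lf y = x + c y *\<^sub>R (y - x)" by metis
  have "eventually (\<lambda>e. e < c y) (at_right 0)" if "y \<in> \<tau>" for y
    using c[OF that] eventually_at_right[of 0 "c y" "\<lambda>e. e < c y"] by auto
  then have "eventually (\<lambda>e. \<forall>y\<in>\<tau>. e < c y) (at_right 0)" using fin by (simp add: eventually_ball_finite)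
  moreover have "eventually (\<lambda>e::real. 0 < e) (at_right 0)" by (simp add: eventually_at_right_less)
  ultimately show ?thesis
  proof eventually_elim
    case (elim e)
    show ?case
    proof
      assume qh: "q \<in> convex hull \<tau>"
      \<comment> \<open>The preimage of the lifted simplex under the homothety with centre
        \<open>x\<close> and ratio \<open>e\<close>.\<close>
      let ?P = "{v. x + e *\<^sub>R (v - x) \<in> convex hull (lift \<tau>)}"
      have "convex ?P"
      proof (rule convexI)
        fix y z and u v :: real
        assume *: "y \<in> ?P" "z \<in> ?P" "0 \<le> u" "0 \<le> v" "u + v = 1"
        then have u: "u = 1 - v" by simp
        have "x + e *\<^sub>R (u *\<^sub>R y + v *\<^sub>R z - x) =
            u *\<^sub>R (x + e *\<^sub>R (y - x)) + v *\<^sub>R (x + e *\<^sub>R (z - x))"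
          unfolding u by (simp add: algebra_simps)
        also have "\<dots> \<in> convex hull (lift \<tau>)"
          using * by (intro convexD convex_convex_hull) auto
        finally show "u *\<^sub>R y + v *\<^sub>R z \<in> ?P" by simp
      qed
      moreover have "\<tau> \<subseteq> ?P"
      proof
        fix y assume y: "y \<in> \<tau>"
        then have cy: "0 < c y" "lf y = x + c y *\<^sub>R (y - x)" "e < c y" using c elim by auto
        have "x + e *\<^sub>R (y - x) = (1 - e / c y) *\<^sub>R x + (e / c y) *\<^sub>R lf y"
          using cy(1) unfolding cy(2) by (simp add: algebra_simps)
        also have "\<dots> \<in> closed_segment x (lf y)"
          unfolding closed_segment_def using cy elim by (auto intro!: exI[of _ "e / c y"])
        also have "\<dots> \<subseteq> convex hull (lift \<tau>)"
          unfolding segment_convex_hull using y by (intro hull_mono) (auto simp: lift_def)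
        finally show "y \<in> ?P" by simp
      qed
      ultimately have "convex hull \<tau> \<subseteq> ?P" by (simp add: hull_minimal)
      then show "x + e *\<^sub>R (q - x) \<in> convex hull lift \<tau>" using qh by auto
    next
      assume p: "x + e *\<^sub>R (q - x) \<in> convex hull lift \<tau>"
      \<comment> \<open>The cone with apex \<open>x\<close> over the hull of \<open>\<tau>\<close>;
        \<open>conic hull\<close> has its apex at the origin, hence the two translations.\<close>
      let ?C = "(\<lambda>v. x + v) ` (conic hull ((\<lambda>y. - x + y) ` (convex hull \<tau>)))"
      have "convex ?C"
        by (intro convex_translation convex_conic_hull convex_convex_hull)
      moreover have "\<tau> \<noteq> {}"
      proof
        assume "\<tau> = {}"
        then have "e *\<^sub>R (q - x) = 0" using p by (simp add: lift_def)
        then show False using elim q x_below by auto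
      qed
      moreover have "lift \<tau> \<subseteq> ?C"
      proof
        fix v assume "v \<in> lift \<tau>"
        then consider "v = x" | y where "y \<in> \<tau>" "v = lf y" by (auto simp: lift_def)
        then show "v \<in> ?C"
        proof cases
          case 1
          then show ?thesis using \<open>\<tau> \<noteq> {}\<close> by (auto simp: image_iff conic_hull_contains_0)
        next
          case 2
          then have "v = x + c y *\<^sub>R (- x + y)" "0 \<le> c y" using c[of y] by (auto simp: algebra_simps)
          then show ?thesis using 2 hull_inc[of y \<tau> convex] unfolding conic_hull_explicit by blast
        qed
      qed
      ultimately have "convex hull (lift \<tau>) \<subseteq> ?C" by (simp add: hull_minimal)
      then obtain s q' where s: "0 \<le> s" "q' \<in> convex hull \<tau>"
        "x + e *\<^sub>R (q - x) = x + s *\<^sub>R (- x + q')"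
        using p unfolding conic_hull_explicit by blast
      have "convex hull \<tau> \<subseteq> {z. a \<bullet> z = b}"
        using \<tau> inner_pr by (intro hull_minimal convex_hyperplane) auto
      then have q': "a \<bullet> q' = b" using s by auto
      \<comment> \<open>Both \<open>q\<close> and \<open>q'\<close> lie at height \<open>b\<close>,
        so comparing heights identifies the two factors.\<close>
      have "a \<bullet> (x + e *\<^sub>R (q - x)) = a \<bullet> (x + s *\<^sub>R (- x + q'))" using s by simp
      then have "e * (b - a \<bullet> x) = s * (b - a \<bullet> x)" by (simp add: inner_simps q q')
      then have "e = s" using x_below by simp
      then have "q = q'" using s elim by simp
      then show "q \<in> convex hull \<tau>" using s by simp
    qed
  qed
qed

end

section \<open>Dimension one\<close>

text \<open>The one-dimensional analogue of the algorithm's output, on which the planar case is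
  built.\<close>

definition consecutive_pairs :: "'a::euclidean_space set \<Rightarrow> 'a set set" where
  "consecutive_pairs X =
     {{y, z} | y z. y \<in> X \<and> z \<in> X \<and> y \<noteq> z \<and> X \<inter> closed_segment y z \<subseteq> {y, z}}"

text \<open>The invariant of the recursion. Here \<open>d\<close> is the dimension of the affine
  space \<open>A\<close>, while the ambient type is the same at all levels. The last two conjuncts
  prepare expressibility and linear independence of the rows.\<close>

definition good_output ::
    "'k::field_char_0 itself \<Rightarrow> nat \<Rightarrow> 'a::euclidean_space set \<Rightarrow> 'a set \<Rightarrow> 'a set set \<Rightarrow> bool" where
  "good_output K d A X B \<longleftrightarrow>
     B \<subseteq> full_simplices d X \<and> generates d X B \<and> generically_independent K A B"

lemma affine_line_parametrization:
  fixes A :: "'a::euclidean_space set"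
  assumes "affine A" "aff_dim A = 1"
  obtains u v where "v \<noteq> 0" "A = range (\<lambda>t. u + t *\<^sub>R v)"
proof -
  have "A \<noteq> {}" using assms by auto
  then obtain x where x: "x \<in> A" by auto
  have "A \<noteq> {x}" using assms by auto
  then obtain y where y: "y \<in> A" "y \<noteq> x" using x by auto
  have "aff_dim (affine hull {x, y}) = 1" using y by (simp add: aff_dim_2)
  then have "affine hull {x, y} = A"
    using assms x y by (intro affine_dim_equal hull_minimal) auto
  moreover have "affine hull {x, y} = range (\<lambda>t. x + t *\<^sub>R (y - x))"
  proof (intro equalityI subsetI)
    fix z assume "z \<in> affine hull {x, y}"
    then obtain s t where "s + t = 1" "z = s *\<^sub>R x + t *\<^sub>R y" by (auto simp: affine_hull_2)
    moreover from this have "s = 1 - t" by simp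
    ultimately have "z = x + t *\<^sub>R (y - x)" by (simp add: algebra_simps)
    then show "z \<in> range (\<lambda>t. x + t *\<^sub>R (y - x))" by auto
  next
    fix z assume "z \<in> range (\<lambda>t. x + t *\<^sub>R (y - x))"
    then obtain t where "z = x + t *\<^sub>R (y - x)" by auto
    then have "z = (1 - t) *\<^sub>R x + t *\<^sub>R y" by (simp add: algebra_simps)
    then show "z \<in> affine hull {x, y}"
      unfolding affine_hull_2 by (intro CollectI exI[of _ "1 - t"] exI[of _ t]) simp
  qed
  ultimately show ?thesis using that[of "y - x" x] y by auto
qed

text \<open>In an affine coordinate on the line, a pair with a point in between is exchanged for the
  two shorter pairs formed with that point. For independence, a generic point of a gap lies in one
  consecutive pair only.\<close>

lemma good_output_consecutive_pairs:
  fixes A :: "'a::euclidean_space set"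
  assumes A: "affine A" "aff_dim A = 1" and X: "finite X" "X \<subseteq> A"
  shows "good_output K 1 A X (consecutive_pairs X)"
proof -
  obtain u v where v: "v \<noteq> 0" and A_eq: "A = range (\<lambda>t. u + t *\<^sub>R v)"
    using affine_line_parametrization[OF A] .
  define g where "g = (\<lambda>t::real. u + t *\<^sub>R v)"
  have A_eq: "A = range g" using A_eq by (simp add: g_def)
  have g_eq: "g s = g t \<longleftrightarrow> s = t" for s t using v by (simp add: g_def)
  then have inj: "inj g" by (simp add: inj_def)
  define T where "T = g -` X"
  have XT: "X = g ` T" using X by (auto simp: T_def A_eq)
  have T: "finite T" unfolding T_def by (rule finite_vimageI[OF X(1) inj])
  have g_seg: "g r \<in> closed_segment (g s) (g t) \<longleftrightarrow> r \<in> closed_segment s t" for r s t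
  proof -
    have "closed_segment (g s) (g t) = (\<lambda>x. u + x) ` (\<lambda>t. t *\<^sub>R v) ` closed_segment s t"
      unfolding g_def closed_segment_translation
      by (subst closed_segment_linear_image) (auto intro: bounded_linear.linear bounded_linear_scaleR_left)
    also have "\<dots> = g ` closed_segment s t" by (auto simp: g_def)
    finally show ?thesis using inj by (simp add: inj_image_mem_iff)
  qed
  have hull: "g r \<in> convex hull {g s, g t} \<longleftrightarrow> s \<le> r \<and> r \<le> t" if "s < t" for r s t
    using that g_seg by (simp add: closed_segment_eq_real_ivl flip: segment_convex_hull)
  have pairI: "{g s, g t} \<in> consecutive_pairs X" if "s \<in> T" "t \<in> T" "s < t" "T \<inter> {s<..<t} = {}" for s t
  proof -
    have "X \<inter> closed_segment (g s) (g t) \<subseteq> {g s, g t}"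
    proof
      fix z assume z: "z \<in> X \<inter> closed_segment (g s) (g t)"
      then obtain r where r: "r \<in> T" "z = g r" using XT by auto
      then have "s \<le> r" "r \<le> t" using z that by (auto simp: g_seg closed_segment_eq_real_ivl)
      then have "r = s \<or> r = t" using that r by force
      then show "z \<in> {g s, g t}" using r by auto
    qed
    moreover have "g s \<in> X" "g t \<in> X" "g s \<noteq> g t" using that XT g_eq by auto
    ultimately show ?thesis
      unfolding consecutive_pairs_def by (intro CollectI exI[of _ "g s"] exI[of _ "g t"]) simp
  qed
  have pairE: "\<exists>s t. s \<in> T \<and> t \<in> T \<and> s < t \<and> T \<inter> {s<..<t} = {} \<and> \<sigma> = {g s, g t}"
    if \<sigma>: "\<sigma> \<in> consecutive_pairs X" for \<sigma>
  proof -
    have *: "T \<inter> {s<..<t} = {}" if "X \<inter> closed_segment (g s) (g t) \<subseteq> {g s, g t}" "s < t" for s t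
    proof (rule ccontr)
      assume "T \<inter> {s<..<t} \<noteq> {}"
      then obtain r where r: "r \<in> T" "s < r" "r < t" by auto
      then have "g r \<in> X \<inter> closed_segment (g s) (g t)"
        using XT by (auto simp: g_seg closed_segment_eq_real_ivl)
      then show False using that r g_eq by auto
    qed
    obtain y z where yz: "y \<in> X" "z \<in> X" "y \<noteq> z" "\<sigma> = {y, z}" "X \<inter> closed_segment y z \<subseteq> {y, z}"
      using \<sigma> unfolding consecutive_pairs_def by blast
    then obtain s t where "s \<in> T" "t \<in> T" "y = g s" "z = g t" using XT by blast
    with yz have st: "s \<in> T" "t \<in> T" "s \<noteq> t" "\<sigma> = {g s, g t}"
      "X \<inter> closed_segment (g s) (g t) \<subseteq> {g s, g t}" by auto
    show ?thesis
    proof (cases "s < t")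
      case True then show ?thesis using st * by blast
    next
      case False
      then have "t < s" using st by auto
      moreover have "X \<inter> closed_segment (g t) (g s) \<subseteq> {g t, g s}"
        using st by (simp add: closed_segment_commute insert_commute)
      ultimately have "T \<inter> {t<..<s} = {}" using * by blast
      then show ?thesis using st \<open>t < s\<close> by (metis insert_commute)
    qed
  qed
  have full_pair: "{y, z} \<in> full_simplices 1 S" if "y \<in> S" "z \<in> S" "y \<noteq> z" for y z and S :: "'a set"
    using that by (simp add: full_simplices_def affine_independent_2)
  have sub: "consecutive_pairs X \<subseteq> full_simplices 1 X"
    unfolding consecutive_pairs_def using full_pair by blast
  have fin: "finite (consecutive_pairs X)"
    using finite_subset[OF sub finite_full_simplices[OF X(1)]] .
  have "generates 1 X (consecutive_pairs X)"
    unfolding generates_def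
  proof (intro allI impI subsetI)
    fix D \<tau> assume D: "consecutive_pairs X \<subseteq> D" "exchange_closed 1 X D"
    have *: "{g s, g t} \<in> D" if "s \<in> T" "t \<in> T" "s < t" for s t
      using that
    proof (induction "card (T \<inter> {s<..<t})" arbitrary: s t rule: less_induct)
      case less
      show ?case
      proof (cases "T \<inter> {s<..<t} = {}")
        case True
        then show ?thesis using pairI less.prems D by blast
      next
        case False
        then obtain r where r: "r \<in> T" "s < r" "r < t" by auto
        have "card (T \<inter> {s<..<r}) < card (T \<inter> {s<..<t})"
          using T r by (intro psubset_card_mono) auto
        then have 1: "{g s, g r} \<in> D" using less r by blast
        have "card (T \<inter> {r<..<t}) < card (T \<inter> {s<..<t})"
          using T r by (intro psubset_card_mono) auto
        then have 2: "{g r, g t} \<in> D" using less r by blast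
        show ?thesis
        proof (rule exchange_closedD[OF D(2)])
          show "{g s, g r, g t} \<subseteq> X" using XT r less.prems by auto
          show "card {g s, g r, g t} = 1 + 2" using r by (simp add: g_eq)
          show "{g s, g t} \<in> full_simplices 1 {g s, g r, g t}"
            using less.prems by (intro full_pair) (auto simp: g_eq)
        next
          fix \<rho> assume \<rho>: "\<rho> \<in> full_simplices 1 {g s, g r, g t}" "\<rho> \<noteq> {g s, g t}"
          then have "card \<rho> = 2" "\<rho> \<subseteq> {g s, g r, g t}" by (auto simp: full_simplices_def)
          then obtain y z where "\<rho> = {y, z}" "y \<noteq> z" by (auto simp: card_2_iff)
          then have "\<rho> = {g s, g r} \<or> \<rho> = {g r, g t}"
            using \<rho>(2) \<open>\<rho> \<subseteq> _\<close> by auto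
          then show "\<rho> \<in> D" using 1 2 by auto
        qed
      qed
    qed
    assume "\<tau> \<in> full_simplices 1 X"
    then have "card \<tau> = 2" "\<tau> \<subseteq> X" by (auto simp: full_simplices_def)
    then obtain y z where yz: "\<tau> = {y, z}" "y \<noteq> z" by (auto simp: card_2_iff)
    then obtain s t where st: "s \<in> T" "t \<in> T" "y = g s" "z = g t" using \<open>\<tau> \<subseteq> X\<close> XT by auto
    then consider "s < t" | "t < s" using yz by (metis linorder_neqE_linordered_idom)
    then show "\<tau> \<in> D"
      using *[of s t] *[of t s] st yz by cases (simp_all add: insert_commute)
  qed
  moreover have "generically_independent K A (consecutive_pairs X)"
    unfolding generically_independent_def
  proof (intro allI impI ballI)
    fix \<beta> :: "'a set \<Rightarrow> 'b" and \<F> \<sigma>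
    assume \<F>: "finite \<F>" "\<forall>F\<in>\<F>. affine F \<and> \<not> A \<subseteq> F"
      and eq: "\<forall>p\<in>A - \<Union>\<F>. (\<Sum>\<sigma>\<in>consecutive_pairs X. \<beta> \<sigma> * of_bool (p \<in> convex hull \<sigma>)) = 0"
      and \<sigma>: "\<sigma> \<in> consecutive_pairs X"
    obtain s t where st: "s \<in> T" "t \<in> T" "s < t" "T \<inter> {s<..<t} = {}" "\<sigma> = {g s, g t}"
      using pairE[OF \<sigma>] by blast
    \<comment> \<open>An affine set that contains two points of a line contains the whole line, so
      each excluded set meets \<open>A\<close> in at most one point.\<close>
    have "finite (g -` F)" if F: "F \<in> \<F>" for F
    proof (rule ccontr)
      assume inf: "infinite (g -` F)"
      then obtain r where r: "r \<in> g -` F" by (metis ex_in_conv finite.emptyI)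
      obtain r' where r': "r' \<in> g -` F" "r' \<noteq> r"
        using inf by (metis finite.emptyI finite_insert finite_subset insertI1 singletonI subsetI)
      have "g w \<in> F" for w
      proof -
        define c where "c = (w - r) / (r' - r)"
        have "(1 - c) *\<^sub>R g r + c *\<^sub>R g r' = u + (r + c * (r' - r)) *\<^sub>R v"
          by (simp add: g_def algebra_simps)
        also have "r + c * (r' - r) = w" using r' by (simp add: c_def)
        finally have "g w = (1 - c) *\<^sub>R g r + c *\<^sub>R g r'" by (simp add: g_def)
        moreover have "(1 - c) *\<^sub>R g r + c *\<^sub>R g r' \<in> F"
          using \<F> F r r' by (intro mem_affine) auto
        ultimately show ?thesis by simp
      qed
      then show False using \<F> F A_eq by auto
    qed
    then have "finite (\<Union>F\<in>\<F>. g -` F)" using \<F> by auto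
    moreover have "infinite {s<..<t}" using st by (simp add: infinite_Ioo)
    ultimately obtain r where r: "r \<in> {s<..<t}" "r \<notin> (\<Union>F\<in>\<F>. g -` F)"
      by (meson finite_subset subsetI)
    have 1: "g r \<in> convex hull \<rho> \<longleftrightarrow> \<rho> = \<sigma>" if \<rho>: "\<rho> \<in> consecutive_pairs X" for \<rho>
    proof
      obtain s' t' where st': "s' \<in> T" "t' \<in> T" "s' < t'" "T \<inter> {s'<..<t'} = {}" "\<rho> = {g s', g t'}"
        using pairE[OF \<rho>] by blast
      assume "g r \<in> convex hull \<rho>"
      then have "s' \<le> r" "r \<le> t'" using st' hull by auto
      \<comment> \<open>Two gaps that share \<open>r\<close> coincide, because no endpoint of one
        lies inside the other.\<close>
      moreover have "s' \<notin> {s<..<t}" "t' \<notin> {s<..<t}" "s \<notin> {s'<..<t'}" "t \<notin> {s'<..<t'}"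
        using st st' by auto
      ultimately have "s' = s" "t' = t" using r by auto
      then show "\<rho> = \<sigma>" using st st' by simp
    qed (use st r hull in auto)
    have "0 = (\<Sum>\<rho>\<in>consecutive_pairs X. \<beta> \<rho> * of_bool (g r \<in> convex hull \<rho>))"
      using eq r A_eq by auto
    also have "\<dots> = (\<Sum>\<rho>\<in>consecutive_pairs X. if \<sigma> = \<rho> then \<beta> \<rho> else 0)"
      using 1 by (intro sum.cong) auto
    also have "\<dots> = \<beta> \<sigma>" using fin \<sigma> by simp
    finally show "\<beta> \<sigma> = 0" by simp
  qed
  ultimately show ?thesis using sub by (simp add: good_output_def)
qed

section \<open>The planar case as a radial section\<close>

context radial_section
begin

text \<open>The angle spanned by two rays is the cone over the segment cut out by the hyperplane, so
  betweenness of rays becomes betweenness of section points.\<close>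

lemma ray_subset_hull_iff:
  assumes "a \<bullet> y = b" "a \<bullet> y1 = b" "a \<bullet> y2 = b"
  shows "ray x y \<subseteq> convex hull (ray x y1 \<union> ray x y2) \<longleftrightarrow> y \<in> closed_segment y1 y2"
proof
  let ?C = "(\<lambda>v. x + v) ` (conic hull ((\<lambda>y. - x + y) ` closed_segment y1 y2))"
  assume "ray x y \<subseteq> convex hull (ray x y1 \<union> ray x y2)"
  moreover have "y \<in> ray x y" unfolding ray_def by (intro CollectI exI[of _ 1]) simp
  ultimately have "y \<in> convex hull (ray x y1 \<union> ray x y2)" by blast
  also have "convex hull (ray x y1 \<union> ray x y2) \<subseteq> ?C"
  proof (rule hull_minimal)
    have "ray x z \<subseteq> ?C" if "z \<in> closed_segment y1 y2" for z
    proof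
      fix w assume "w \<in> ray x z"
      then obtain t where "0 \<le> t" "w = x + t *\<^sub>R (- x + z)" by (auto simp: ray_def)
      then show "w \<in> ?C" using that unfolding conic_hull_explicit by blast
    qed
    then show "ray x y1 \<union> ray x y2 \<subseteq> ?C" by simp
    show "convex ?C" by (intro convex_translation convex_conic_hull convex_closed_segment)
  qed
  finally obtain s z where s: "0 \<le> s" "z \<in> closed_segment y1 y2" "y = x + s *\<^sub>R (- x + z)"
    unfolding conic_hull_explicit by blast
  have "closed_segment y1 y2 \<subseteq> {z. a \<bullet> z = b}"
    unfolding segment_convex_hull using assms by (intro hull_minimal convex_hyperplane) auto
  then have "a \<bullet> z = b" using s by auto
  \<comment> \<open>Both \<open>y\<close> and \<open>z\<close> lie at height \<open>b\<close>, which
    forces the factor \<open>s\<close> to be 1.\<close>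
  moreover have "a \<bullet> y = a \<bullet> x + s * (a \<bullet> z - a \<bullet> x)" unfolding s(3) by (simp add: inner_simps)
  ultimately have "(b - a \<bullet> x) * (1 - s) = 0" using assms by (simp add: algebra_simps)
  then have "s = 1" using x_below by simp
  then show "y \<in> closed_segment y1 y2" using s by simp
next
  assume "y \<in> closed_segment y1 y2"
  then obtain c where c: "0 \<le> c" "c \<le> 1" "y = (1 - c) *\<^sub>R y1 + c *\<^sub>R y2"
    by (auto simp: closed_segment_def)
  show "ray x y \<subseteq> convex hull (ray x y1 \<union> ray x y2)"
  proof
    fix w assume "w \<in> ray x y"
    then obtain t where t: "0 \<le> t" "w = x + t *\<^sub>R (y - x)" by (auto simp: ray_def)
    then have "w = (1 - c) *\<^sub>R (x + t *\<^sub>R (y1 - x)) + c *\<^sub>R (x + t *\<^sub>R (y2 - x))"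
      unfolding c(3) by (simp add: algebra_simps)
    moreover have "x + t *\<^sub>R (y1 - x) \<in> ray x y1" "x + t *\<^sub>R (y2 - x) \<in> ray x y2"
      using t by (auto simp: ray_def)
    ultimately show "w \<in> convex hull (ray x y1 \<union> ray x y2)"
      using c convexD[OF convex_convex_hull, of "x + t *\<^sub>R (y1 - x)" "ray x y1 \<union> ray x y2"
          "x + t *\<^sub>R (y2 - x)" "1 - c" c]
      by (simp add: hull_inc)
  qed
qed

lemma ray_eq_iff:
  assumes "a \<bullet> y = b" "a \<bullet> z = b"
  shows "ray x y = ray x z \<longleftrightarrow> y = z"
  using ray_subset_hull_iff[of y z z] assms
  by (metis Un_absorb closed_segment_idem hull_subset singletonD)

lemma neighbouring_rays_iff:
  assumes "y1 \<in> pr ` Y" "y2 \<in> pr ` Y"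
  shows "neighbouring_rays (ray x ` Y) (ray x y1) (ray x y2) \<longleftrightarrow>
    y1 \<noteq> y2 \<and> pr ` Y \<inter> closed_segment y1 y2 \<subseteq> {y1, y2}"
proof -
  have rays: "ray x ` Y = ray x ` pr ` Y" by (auto simp: ray_pr image_image)
  have ab: "a \<bullet> y = b" if "y \<in> pr ` Y" for y using that inner_pr by auto
  show ?thesis
    unfolding neighbouring_rays_def rays
    using assms by (auto simp: ray_eq_iff ray_subset_hull_iff ab)
qed

text \<open>This brings the planar rule into the form of the general step: neighbouring rays
  correspond to consecutive section points.\<close>

lemma neighbouring_rays_triangles:
  "{{x, N r1, N r2} | r1 r2. neighbouring_rays (ray x ` Y) r1 r2} = lift ` consecutive_pairs (pr ` Y)"
  (is "?L = ?R")
proof (intro equalityI subsetI)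
  fix \<sigma> assume "\<sigma> \<in> ?L"
  then obtain r1 r2 where r: "\<sigma> = {x, N r1, N r2}" "neighbouring_rays (ray x ` Y) r1 r2" by auto
  then obtain z1 z2 where z: "z1 \<in> Y" "z2 \<in> Y" "r1 = ray x z1" "r2 = ray x z2"
    unfolding neighbouring_rays_def by auto
  then have "{pr z1, pr z2} \<in> consecutive_pairs (pr ` Y)"
    using r(2) neighbouring_rays_iff[of "pr z1" "pr z2"]
    unfolding consecutive_pairs_def by (auto simp: ray_pr)
  moreover have "\<sigma> = lift {pr z1, pr z2}" using r z by (simp add: lift_def lf_def ray_pr)
  ultimately show "\<sigma> \<in> ?R" by blast
next
  fix \<sigma> assume "\<sigma> \<in> ?R"
  then obtain y1 y2 where y: "y1 \<in> pr ` Y" "y2 \<in> pr ` Y" "y1 \<noteq> y2"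
     "pr ` Y \<inter> closed_segment y1 y2 \<subseteq> {y1, y2}" "\<sigma> = lift {y1, y2}"
    unfolding consecutive_pairs_def by blast
  then have "neighbouring_rays (ray x ` Y) (ray x y1) (ray x y2)"
    using neighbouring_rays_iff by blast
  moreover have "\<sigma> = {x, N (ray x y1), N (ray x y2)}" using y by (simp add: lift_def lf_def)
  ultimately show "\<sigma> \<in> ?L" by blast
qed

end

section \<open>The induction step\<close>

text \<open>As \<open>x\<close> lies below the hyperplane and \<open>Y\<close> above it, the
  projection of a point of \<open>Y\<close> is interior to the segment from \<open>x\<close> to that
  point.\<close>

lemma section_points_eq:
  assumes "radial_section x a b Y N" "affine A" "x \<in> A" "Y \<subseteq> A" "H = {z \<in> A. a \<bullet> z = b}"
  shows "section_points H x Y = radial_section.pr x a b ` Y"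
proof -
  interpret radial_section x a b Y N by fact
  show ?thesis
  proof (intro equalityI subsetI)
    fix y assume "y \<in> section_points H x Y"
    then obtain z where z: "z \<in> Y" "y \<in> open_segment x z" "a \<bullet> y = b"
      using assms by (auto simp: section_points_def)
    then obtain t where t: "0 < t" "t < 1" "y = x + t *\<^sub>R (z - x)"
      by (auto simp: in_segment algebra_simps)
    have "z = x + (1 / t) *\<^sub>R (y - x)" using t by simp
    then have "pr z = y" using pr_scale[of y "1/t"] z t by simp
    then show "y \<in> pr ` Y" using z by auto
  next
    fix y assume "y \<in> pr ` Y"
    then obtain z where z: "z \<in> Y" "y = pr z" by auto
    define t where "t = (b - a \<bullet> x) / (a \<bullet> z - a \<bullet> x)"
    have t: "0 < t" "t < 1" using pr_coeff_pos[OF z(1)] x_below Y_above[OF z(1)] by (auto simp: t_def)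
    have y: "y = (1 - t) *\<^sub>R x + t *\<^sub>R z" unfolding z pr_def t_def[symmetric] by (simp add: algebra_simps)
    then have "y \<in> A" using assms z by (auto intro: mem_affine)
    moreover have "y \<in> open_segment x z"
      using t y z x_notin_Y unfolding in_segment by auto
    ultimately show "y \<in> section_points H x Y"
      using z inner_pr[OF z(1)] by (auto simp: section_points_def assms)
  qed
qed

section \<open>One stage of the algorithm as a radial section\<close>

text \<open>The minimum is taken over all of \<open>X\<close>, so a point \<open>w\<close> preceding
  \<open>x\<close> in the ordering has to be excluded. Either \<open>w\<close> would lie between
  \<open>x\<close> and \<open>z\<close>, or \<open>z\<close> between \<open>x\<close> and
  \<open>w\<close>; this contradicts the disjointness of hulls just before and just after
  \<open>x\<close>, respectively.\<close>

lemma nearest_in_later_points: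
  assumes xs: "admissible_ordering X xs" and k: "k < length xs" and z: "z \<in> set (drop (Suc k) xs)"
  shows "nearest X (xs ! k) (ray (xs ! k) z) \<in> set (drop (Suc k) xs) \<inter> ray (xs ! k) z"
proof -
  define x where "x = xs ! k"
  define w where "w = nearest X x (ray x z)"
  have X: "X = set xs" "distinct xs" using xs by (auto simp: admissible_ordering_def)
  have adm: "convex hull set (take j xs) \<inter> convex hull set (drop j xs) = {}" if "1 \<le> j" "j \<le> length xs" for j
    using xs that by (auto simp: admissible_ordering_def)
  have xdrop: "drop k xs = x # drop (Suc k) xs" using k by (simp add: Cons_nth_drop_Suc x_def)
  have xtake: "take (Suc k) xs = take k xs @ [x]" using k by (simp add: take_Suc_conv_app_nth x_def)
  have "distinct (drop k xs)" using X by simp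
  then have zx: "z \<noteq> x" using z xdrop by auto
  have z_ray: "z \<in> (X - {x}) \<inter> ray x z"
  proof -
    have "z \<in> ray x z" unfolding ray_def by (intro CollectI exI[of _ 1]) simp
    then show ?thesis using z zx X in_set_dropD[of z] by auto
  qed
  have "w \<in> (X - {x}) \<inter> ray x z"
    unfolding w_def nearest_def
  proof (rule arg_min_if_finite(1))
    show "finite ((X - {x}) \<inter> ray x z)" using X by simp
    show "(X - {x}) \<inter> ray x z \<noteq> {}" using z_ray by blast
  qed
  then have w: "w \<in> X" "w \<noteq> x" "w \<in> ray x z" by auto
  then obtain t where t: "0 \<le> t" "w = x + t *\<^sub>R (z - x)" by (auto simp: ray_def)
  have "set xs = set (take (Suc k) xs) \<union> set (drop (Suc k) xs)"
    by (metis append_take_drop_id set_append)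
  moreover have "w \<notin> set (take k xs)"
  proof
    assume wk: "w \<in> set (take k xs)"
    show False
    proof (cases "t \<le> 1")
      case True
      have "w = (1 - t) *\<^sub>R x + t *\<^sub>R z" using t by (simp add: algebra_simps)
      then have "w \<in> closed_segment x z" using t True by (auto simp: in_segment)
      also have "\<dots> \<subseteq> convex hull set (drop k xs)"
        unfolding segment_convex_hull using z xdrop by (intro hull_mono) auto
      finally have "w \<in> convex hull set (take k xs) \<inter> convex hull set (drop k xs)"
        using wk by (auto intro: hull_inc)
      \<comment> \<open>Disjointness is available for nonempty initial segments; the existence of
        \<open>w\<close> ensures that this one is nonempty.\<close>
      moreover have "1 \<le> k" using wk by (cases k) auto
      ultimately show False using adm[of k] k by auto
    next
      case False
      then have "z = (1 - 1 / t) *\<^sub>R x + (1 / t) *\<^sub>R w" unfolding t(2) by (simp add: algebra_simps)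
      then have "z \<in> closed_segment x w" using False by (auto simp: in_segment intro!: exI[of _ "1/t"])
      also have "\<dots> \<subseteq> convex hull set (take (Suc k) xs)"
        unfolding segment_convex_hull using wk xtake by (intro hull_mono) auto
      finally have "z \<in> convex hull set (take (Suc k) xs) \<inter> convex hull set (drop (Suc k) xs)"
        using z by (auto intro: hull_inc)
      then show False using adm[of "Suc k"] k by auto
    qed
  qed
  ultimately have "w \<in> set (drop (Suc k) xs)" using w X xtake by auto
  then show ?thesis using w by (simp add: w_def x_def)
qed

text \<open>Translates the section points and the lifted simplices of one stage into
  \<open>pr\<close> and \<open>lift\<close>, so that the results of \<open>radial_section\<close>
  apply to them.\<close>

lemma separating_hyperplane_radial_section:
  assumes xs: "admissible_ordering X xs" and k: "Suc k < length xs" and A: "affine A" "X \<subseteq> A"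
    and H: "separating_hyperplane A H (convex hull set (take (Suc k) xs)) (convex hull set (drop (Suc k) xs))"
  obtains a b where "radial_section (xs ! k) a b (set (drop (Suc k) xs)) (nearest X (xs ! k))"
    "H = {z \<in> A. a \<bullet> z = b}" "aff_dim H = aff_dim A - 1"
    "section_points H (xs ! k) (set (drop (Suc k) xs)) =
       radial_section.pr (xs ! k) a b ` set (drop (Suc k) xs)"
    "lift_simplex X (xs ! k) = radial_section.lift (xs ! k) (nearest X (xs ! k))"
proof -
  obtain a b where ab: "aff_dim H = aff_dim A - 1" "H = {z \<in> A. a \<bullet> z = b}"
    "\<And>z. z \<in> convex hull set (take (Suc k) xs) \<Longrightarrow> a \<bullet> z < b"
    "\<And>z. z \<in> convex hull set (drop (Suc k) xs) \<Longrightarrow> b < a \<bullet> z"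
    using H unfolding separating_hyperplane_def by auto
  have x: "xs ! k \<in> set (take (Suc k) xs)" using k by (simp add: take_Suc_conv_app_nth)
  have rs: "radial_section (xs ! k) a b (set (drop (Suc k) xs)) (nearest X (xs ! k))"
  proof
    show "a \<bullet> xs ! k < b" using ab x by (simp add: hull_inc)
    show "b < a \<bullet> z" if "z \<in> set (drop (Suc k) xs)" for z using ab that by (simp add: hull_inc)
  qed (use nearest_in_later_points[OF xs] k in auto)
  interpret radial_section "xs ! k" a b "set (drop (Suc k) xs)" "nearest X (xs ! k)" by fact
  have X: "X = set xs" using xs by (simp add: admissible_ordering_def)
  have "set (drop (Suc k) xs) \<subseteq> A" "xs ! k \<in> A" using A X k by (auto dest: in_set_dropD)
  then have "section_points H (xs ! k) (set (drop (Suc k) xs)) = pr ` set (drop (Suc k) xs)"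
    using section_points_eq[OF rs A(1)] ab by simp
  moreover have "lift_simplex X (xs ! k) = lift"
    by (simp add: lift_simplex_def lift_def lf_def fun_eq_iff)
  ultimately show ?thesis using that[OF rs] ab by blast
qed

text \<open>Generation is proved by descending induction over the final segments of the ordering,
  independence by ascending induction over the stages. In both cases the invariant of the section in
  \<open>H k\<close> settles the simplices with apex \<open>xs ! k\<close>.\<close>

lemma good_output_step:
  fixes A :: "'a::euclidean_space set"
  assumes A: "affine A" "aff_dim A = int (Suc d)" "finite X" "X \<subseteq> A" and xs: "admissible_ordering X xs"
    and H: "\<And>k. Suc k < length xs \<Longrightarrow> separating_hyperplane A (H k)
           (convex hull set (take (Suc k) xs)) (convex hull set (drop (Suc k) xs))"
    and B': "\<And>k. Suc k < length xs \<Longrightarrow>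
        good_output TYPE('k::field_char_0) d (H k) (section_points (H k) (xs ! k) (set (drop (Suc k) xs))) (B' k)"
  shows "good_output TYPE('k::field_char_0) (Suc d) A X (\<Union>k\<in>{k. Suc k < length xs}. lift_simplex X (xs ! k) ` B' k)"
    (is "good_output TYPE('k::field_char_0) _ A X ?B")
proof -
  have X: "X = set xs" using xs by (simp add: admissible_ordering_def)
  define Bk where "Bk k = lift_simplex X (xs ! k) ` B' k" for k
  have drop_eq: "set (drop k xs) = insert (xs ! k) (set (drop (Suc k) xs))" if "k < length xs" for k
    using Cons_nth_drop_Suc[OF that] by (metis list.simps(15))
  have Bk: "Bk k \<subseteq> full_simplices (Suc d) (set (drop k xs))" if k: "Suc k < length xs" for k
  proof -
    obtain a b where rs: "radial_section (xs ! k) a b (set (drop (Suc k) xs)) (nearest X (xs ! k))"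
      "H k = {z \<in> A. a \<bullet> z = b}" "aff_dim (H k) = aff_dim A - 1"
      "section_points (H k) (xs ! k) (set (drop (Suc k) xs)) =
         radial_section.pr (xs ! k) a b ` set (drop (Suc k) xs)"
      "lift_simplex X (xs ! k) = radial_section.lift (xs ! k) (nearest X (xs ! k))"
      using separating_hyperplane_radial_section[OF xs k A(1,4) H[OF k]] by blast
    interpret radial_section "xs ! k" a b "set (drop (Suc k) xs)" "nearest X (xs ! k)" by fact
    have "lift \<tau> \<in> full_simplices (Suc d) (set (drop k xs))" if "\<tau> \<in> B' k" for \<tau>
    proof -
      have \<tau>: "\<tau> \<in> full_simplices d (pr ` set (drop (Suc k) xs))"
        using that B'[OF k] rs unfolding good_output_def by auto
      then have "\<tau> \<subseteq> pr ` set (drop (Suc k) xs)" by (simp add: full_simplices_def)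
      moreover from this have "lift \<tau> \<subseteq> set (drop k xs)"
        using lf_image_subset[of \<tau>] drop_eq[of k] k by (auto simp: lift_def)
      ultimately show ?thesis using \<tau> lift_full_simplices by simp
    qed
    then show ?thesis using rs by (auto simp: Bk_def)
  qed
  have B: "?B = (\<Union>k\<in>{k. Suc k < length xs}. Bk k)" by (simp add: Bk_def)
  have sub: "?B \<subseteq> full_simplices (Suc d) X"
  proof -
    have "full_simplices (Suc d) (set (drop k xs)) \<subseteq> full_simplices (Suc d) X" for k
      unfolding X by (intro full_simplices_mono set_drop_subset)
    then show ?thesis unfolding B using Bk by blast
  qed
  have fin: "finite ?B" using finite_subset[OF sub finite_full_simplices[OF A(3)]] .
  have "generates (Suc d) X ?B"
    unfolding generates_def
  proof (intro allI impI)
    fix D assume D: "?B \<subseteq> D" "exchange_closed (Suc d) X D"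
    \<comment> \<open>Covers the empty final segment and the one consisting of the last
      point.\<close>
    have small: "full_simplices (Suc d) S = {}" if "card S \<le> 1" "finite S" for S :: "'a set"
    proof -
      have "card \<sigma> \<noteq> Suc (Suc d)" if "\<sigma> \<subseteq> S" for \<sigma>
        using card_mono[OF \<open>finite S\<close> that] \<open>card S \<le> 1\<close> by simp
      then show ?thesis unfolding full_simplices_def by blast
    qed
    have "full_simplices (Suc d) (set (drop k xs)) \<subseteq> D" if "k \<le> length xs" for k
      using that
    proof (induction rule: inc_induct)
      case base
      then show ?case using small[of "{}"] by simp
    next
      case (step k)
      show ?case
      proof (cases "Suc k = length xs")
        case True
        then have "set (drop k xs) = {xs ! k}" using drop_eq[of k] by simp
        then show ?thesis using small[of "{xs ! k}"] by simp
      next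
        case False
        then have k: "Suc k < length xs" using step by simp
        obtain a b where rs: "radial_section (xs ! k) a b (set (drop (Suc k) xs)) (nearest X (xs ! k))"
          "H k = {z \<in> A. a \<bullet> z = b}" "aff_dim (H k) = aff_dim A - 1"
          "section_points (H k) (xs ! k) (set (drop (Suc k) xs)) =
             radial_section.pr (xs ! k) a b ` set (drop (Suc k) xs)"
          "lift_simplex X (xs ! k) = radial_section.lift (xs ! k) (nearest X (xs ! k))"
          using separating_hyperplane_radial_section[OF xs k A(1,4) H[OF k]] by blast
        interpret radial_section "xs ! k" a b "set (drop (Suc k) xs)" "nearest X (xs ! k)" by fact
        have "full_simplices (Suc d) (insert (xs ! k) (set (drop (Suc k) xs))) \<subseteq> D"
        proof (rule insert_in_exchange_closed[OF _ D(2)])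
          show "generates d (pr ` set (drop (Suc k) xs)) (B' k)"
            "B' k \<subseteq> full_simplices d (pr ` set (drop (Suc k) xs))"
            using B'[OF k] rs by (simp_all add: good_output_def)
          show "insert (xs ! k) (set (drop (Suc k) xs)) \<subseteq> X"
            unfolding X using k by (auto dest: in_set_dropD)
          have "lift ` B' k = Bk k" using rs by (auto simp: Bk_def)
          then show "lift ` B' k \<subseteq> D" using D(1) k unfolding B by blast
        qed (rule step.IH)
        then show ?thesis using drop_eq[of k] k by simp
      qed
    qed
    from this[of 0] show "full_simplices (Suc d) X \<subseteq> D" by (simp add: X)
  qed
  moreover have "generically_independent TYPE('k) A ?B"
    unfolding generically_independent_def
  proof (intro allI impI)
    fix \<beta> :: "'a set \<Rightarrow> 'k" and \<F>
    assume \<F>: "finite \<F>" "\<forall>F\<in>\<F>. affine F \<and> \<not> A \<subseteq> F"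
      and eq: "\<forall>p\<in>A - \<Union>\<F>. (\<Sum>\<sigma>\<in>?B. \<beta> \<sigma> * of_bool (p \<in> convex hull \<sigma>)) = 0"
    \<comment> \<open>At the first stage not yet treated, the coefficients of earlier stages vanish
      by induction, and simplices of later stages do not reach the points near \<open>xs ! k\<close>
      used below.\<close>
    have "\<forall>\<sigma>\<in>Bk k. \<beta> \<sigma> = 0" if "Suc k < length xs" for k
      using that
    proof (induction k rule: less_induct)
      case (less k)
      note k = less.prems
      define x where "x = xs ! k"
      define Y where "Y = set (drop (Suc k) xs)"
      obtain a b where rs: "radial_section x a b Y (nearest X x)"
        and Hk: "H k = {z \<in> A. a \<bullet> z = b}" and dimH: "aff_dim (H k) = aff_dim A - 1"
        and sp: "section_points (H k) x Y = radial_section.pr x a b ` Y"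
        and ls: "lift_simplex X x = radial_section.lift x (nearest X x)"
        using separating_hyperplane_radial_section[OF xs k A(1,4) H[OF k], folded x_def Y_def] by blast
      interpret radial_section x a b Y "nearest X x" by fact
      have xA: "x \<in> A" using A X k by (auto simp: x_def)
      have B'k: "B' k \<subseteq> full_simplices d (pr ` Y)" "generically_independent TYPE('k) (H k) (B' k)"
        using B'[OF k, folded x_def Y_def] sp by (simp_all add: good_output_def)
      have B'sub: "B' k \<subseteq> Pow (pr ` Y)" using B'k by (auto simp: full_simplices_def)
      have "finite (pr ` Y)" using finite_Y by simp
      then have finB': "finite (B' k)" using B'sub by (meson finite_Pow_iff finite_subset)
      have Bkl: "Bk k = lift ` B' k" using ls by (auto simp: Bk_def x_def)
      have "\<forall>\<tau>\<in>B' k. \<beta> (lift \<tau>) = 0"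
      proof
        fix \<tau> assume "\<tau> \<in> B' k"
        show "\<beta> (lift \<tau>) = 0"
        \<comment> \<open>Only the excluded sets through \<open>x\<close> restrict the direction
          \<open>q\<close>: the others are closed and avoid a neighbourhood of
          \<open>x\<close>.\<close>
        proof (rule generically_independentD[where \<beta> = "\<lambda>\<tau>. \<beta> (lift \<tau>)" and \<F> = "{F \<in> \<F>. x \<in> F}"])
          show "generically_independent TYPE('k) (H k) (B' k)" "\<tau> \<in> B' k" by fact+
          show "finite {F \<in> \<F>. x \<in> F}" using \<F> by simp
          fix F assume F: "F \<in> {F \<in> \<F>. x \<in> F}"
          show "affine F \<and> \<not> H k \<subseteq> F"
          proof
            show "affine F" using \<F> F by auto
            show "\<not> H k \<subseteq> F"
            proof
              \<comment> \<open>Together with \<open>x\<close>, the hyperplane \<open>H k\<close>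
                has full dimension in \<open>A\<close>, so \<open>F\<close> would contain
                \<open>A\<close>.\<close>
              assume HF: "H k \<subseteq> F"
              have "affine hull (H k) \<subseteq> {z. a \<bullet> z = b}"
                using Hk by (intro hull_minimal affine_hyperplane) auto
              then have "x \<notin> affine hull (H k)" using x_below by auto
              then have "aff_dim A = aff_dim (insert x (H k))" using dimH by (simp add: aff_dim_insert)
              also have "\<dots> \<le> aff_dim (F \<inter> A)"
                using HF Hk xA F by (intro aff_dim_subset) auto
              finally have "aff_dim (F \<inter> A) = aff_dim A"
                using aff_dim_subset[of "F \<inter> A" A] by simp
              then have "F \<inter> A = A"
                using A(1) \<open>affine F\<close> xA F by (intro affine_dim_equal affine_Int) auto
              then show False using \<F> F by auto
            qed
          qed
        next
          fix q assume q: "q \<in> H k" "q \<notin> \<Union>{F \<in> \<F>. x \<in> F}"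
          \<comment> \<open>Test points on the segment from \<open>x\<close> to \<open>q\<close>,
            pushed towards \<open>x\<close> as \<open>e\<close> tends to 0.\<close>
          let ?p = "\<lambda>e. x + e *\<^sub>R (q - x)"
          have qb: "a \<bullet> q = b" "q \<in> A" using q Hk by auto
          have ev0: "eventually (\<lambda>e::real. 0 < e) (at_right 0)" by (simp add: eventually_at_right_less)
          have "eventually (\<lambda>e. ?p e \<notin> F) (at_right 0)" if F: "F \<in> \<F>" for F
          proof (cases "x \<in> F")
            case False
            have "affine F" using \<F> F by auto
            then have "open (- F)" using closed_affine_hull[of F] by (simp add: hull_same open_Compl)
            moreover have "(?p \<longlongrightarrow> x + 0 *\<^sub>R (q - x)) (at_right 0)" by (intro tendsto_intros)
            ultimately have "eventually (\<lambda>e. ?p e \<in> - F) (at_right 0)"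
              using False topological_tendstoD[of ?p _ _ "- F"] by simp
            then show ?thesis by simp
          next
            case True
            have "?p e \<notin> F" if e: "0 < e" for e
            proof
              assume pF: "?p e \<in> F"
              \<comment> \<open>The line through \<open>x\<close> and the test point contains
                \<open>q\<close>, so an excluded set containing both would contain
                \<open>q\<close>.\<close>
              have "(1 - 1 / e) *\<^sub>R x + (1 / e) *\<^sub>R ?p e \<in> F"
                using \<F> F True pF by (intro mem_affine) auto
              moreover have "(1 - 1 / e) *\<^sub>R x + (1 / e) *\<^sub>R ?p e = q"
                using e by (simp add: algebra_simps)
              ultimately show False using q F True by auto
            qed
            then show ?thesis using ev0 by (rule eventually_mono[rotated])
          qed
          then have "eventually (\<lambda>e. \<forall>F\<in>\<F>. ?p e \<notin> F) (at_right 0)"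
            using \<F> by (simp add: eventually_ball_finite)
          moreover have "eventually (\<lambda>e. \<forall>\<tau>\<in>B' k. ?p e \<in> convex hull (lift \<tau>) \<longleftrightarrow> q \<in> convex hull \<tau>) (at_right 0)"
            using B'sub eventually_lift_hull[OF _ qb(1)] finB' by (intro eventually_ball_finite) auto
          moreover have "eventually (\<lambda>e::real. e < 1) (at_right 0)"
            using order_tendstoD(2)[OF tendsto_ident_at, of "0::real" 1] by simp
          ultimately have "eventually (\<lambda>e. 0 < e \<and> e < 1 \<and> (\<forall>F\<in>\<F>. ?p e \<notin> F) \<and>
              (\<forall>\<tau>\<in>B' k. ?p e \<in> convex hull (lift \<tau>) \<longleftrightarrow> q \<in> convex hull \<tau>)) (at_right 0)"
            using ev0 by eventually_elim auto
          then obtain e where e: "0 < e" "e < 1" "\<forall>F\<in>\<F>. ?p e \<notin> F"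
              "\<forall>\<tau>\<in>B' k. ?p e \<in> convex hull (lift \<tau>) \<longleftrightarrow> q \<in> convex hull \<tau>"
            using eventually_happens'[OF trivial_limit_at_right_real] by blast
          have "?p e = (1 - e) *\<^sub>R x + e *\<^sub>R q" by (simp add: algebra_simps)
          then have "?p e \<in> A" using A(1) xA qb by (simp add: mem_affine)
          \<comment> \<open>With \<open>e\<close> less than 1 the test point stays on the side of
            \<open>x\<close>, whereas simplices of later stages lie strictly on the other
            side.\<close>
          have "a \<bullet> ?p e = a \<bullet> x + e * (b - a \<bullet> x)" by (simp add: inner_simps qb)
          also have "\<dots> < a \<bullet> x + 1 * (b - a \<bullet> x)"
            using e x_below by (intro add_strict_left_mono mult_strict_right_mono) auto
          finally have below: "a \<bullet> ?p e < b" by simp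
          have zero: "\<beta> \<sigma> * of_bool (?p e \<in> convex hull \<sigma>) = 0" if \<sigma>: "\<sigma> \<in> ?B - Bk k" for \<sigma>
          proof -
            obtain j where j: "Suc j < length xs" "\<sigma> \<in> Bk j" using \<sigma> unfolding B by auto
            then consider "j < k" | "k < j" using \<sigma> by (metis DiffD2 linorder_neqE_nat)
            then show ?thesis
            proof cases
              case 1
              then show ?thesis using less.IH j by simp
            next
              case 2
              have "\<sigma> \<subseteq> set (drop j xs)" using Bk[OF j(1)] j by (auto simp: full_simplices_def)
              also have "\<dots> \<subseteq> Y" unfolding Y_def using 2 by (intro set_drop_subset_set_drop) simp
              finally have "convex hull \<sigma> \<subseteq> {z. b < a \<bullet> z}"
                using Y_above by (intro hull_minimal convex_halfspace_gt) auto
              then show ?thesis using below by auto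
            qed
          qed
          have "0 = (\<Sum>\<sigma>\<in>?B. \<beta> \<sigma> * of_bool (?p e \<in> convex hull \<sigma>))"
            using eq \<open>?p e \<in> A\<close> e by auto
          also have "\<dots> = (\<Sum>\<sigma>\<in>Bk k. \<beta> \<sigma> * of_bool (?p e \<in> convex hull \<sigma>))"
            using fin zero k unfolding B by (intro sum.mono_neutral_right) auto
          also have "\<dots> = (\<Sum>\<tau>\<in>B' k. \<beta> (lift \<tau>) * of_bool (?p e \<in> convex hull (lift \<tau>)))"
            unfolding Bkl using inj_on_subset[OF inj_lift B'sub] by (simp add: sum.reindex)
          also have "\<dots> = (\<Sum>\<tau>\<in>B' k. \<beta> (lift \<tau>) * of_bool (q \<in> convex hull \<tau>))"
            using e by (intro sum.cong) auto
          finally show "(\<Sum>\<tau>\<in>B' k. \<beta> (lift \<tau>) * of_bool (q \<in> convex hull \<tau>)) = 0" by simp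
        qed
      qed
      then show ?case by (simp add: Bkl)
    qed
    then show "\<forall>\<sigma>\<in>?B. \<beta> \<sigma> = 0" unfolding B by blast
  qed
  ultimately show ?thesis using sub by (simp add: good_output_def)
qed

section \<open>The invariant holds for every output of the algorithm\<close>

text \<open>Supplies auxiliary lines in the planar case, where the algorithm chooses none. A segment
  from \<open>S\<close> to \<open>T\<close> crosses the separating level, so the hyperplane meets
  \<open>A\<close> without containing it.\<close>

lemma exists_separating_hyperplane:
  fixes A :: "'a::euclidean_space set"
  assumes A: "affine A" "S \<union> T \<subseteq> A" and fin: "finite S" "finite T" "S \<noteq> {}" "T \<noteq> {}"
    and disj: "convex hull S \<inter> convex hull T = {}"
  shows "\<exists>H. separating_hyperplane A H (convex hull S) (convex hull T)"
proof -
  obtain a b where ab: "\<forall>x\<in>convex hull S. a \<bullet> x < b" "\<forall>x\<in>convex hull T. b < a \<bullet> x"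
    using separating_hyperplane_compact_closed[of "convex hull S" "convex hull T"] fin disj
    by (auto simp: finite_imp_compact_convex_hull compact_imp_closed)
  obtain x y where xy: "x \<in> S" "y \<in> T" using fin by blast
  then have "a \<bullet> x < b" "b < a \<bullet> y" using ab by (auto simp: hull_inc)
  \<comment> \<open>The parameter at which the segment from \<open>x\<close> to \<open>y\<close>
    reaches the level \<open>b\<close>.\<close>
  define t where "t = (b - a \<bullet> x) / (a \<bullet> y - a \<bullet> x)"
  have "a \<bullet> ((1 - t) *\<^sub>R x + t *\<^sub>R y) = a \<bullet> x + t * (a \<bullet> y - a \<bullet> x)" by (simp add: inner_simps algebra_simps)
  also have "\<dots> = b" using \<open>a \<bullet> x < b\<close> \<open>b < a \<bullet> y\<close> by (simp add: t_def)
  finally have "(1 - t) *\<^sub>R x + t *\<^sub>R y \<in> A \<inter> {x. a \<bullet> x = b}"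
    using A xy by (auto intro: mem_affine)
  moreover have "\<not> A \<subseteq> {x. a \<bullet> x = b}" using A xy \<open>a \<bullet> x < b\<close> by auto
  ultimately have "aff_dim (A \<inter> {x. a \<bullet> x = b}) = aff_dim A - 1"
    using aff_dim_affine_Int_hyperplane[OF A(1), of a b] by auto
  moreover have "A \<inter> {x. a \<bullet> x = b} = {x \<in> A. a \<bullet> x = b}" by auto
  ultimately have "separating_hyperplane A {x \<in> A. a \<bullet> x = b} (convex hull S) (convex hull T)"
    unfolding separating_hyperplane_def using ab by (intro conjI exI[of _ a] exI[of _ b]) simp_all
  then show ?thesis ..
qed

lemma algorithm_output_good:
  "algorithm_output A X B \<Longrightarrow> good_output TYPE('k::field_char_0) (nat (aff_dim A)) A X B"
proof (induction rule: algorithm_output.induct)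
  case (plane A X xs)
  have X: "X = set xs" using plane by (simp add: admissible_ordering_def)
  have "\<exists>H. separating_hyperplane A H (convex hull set (take (Suc k) xs)) (convex hull set (drop (Suc k) xs))"
    if k: "Suc k < length xs" for k
  proof (rule exists_separating_hyperplane)
    show "set (take (Suc k) xs) \<union> set (drop (Suc k) xs) \<subseteq> A"
      using plane X by (auto dest: in_set_takeD in_set_dropD)
    show "convex hull set (take (Suc k) xs) \<inter> convex hull set (drop (Suc k) xs) = {}"
      using plane(5) k unfolding admissible_ordering_def by auto
    show "set (take (Suc k) xs) \<noteq> {}" "set (drop (Suc k) xs) \<noteq> {}" using k by auto
  qed (use plane in auto)
  then obtain H where H: "\<And>k. Suc k < length xs \<Longrightarrow> separating_hyperplane A (H k)
      (convex hull set (take (Suc k) xs)) (convex hull set (drop (Suc k) xs))" by metis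
  define B' where "B' k = consecutive_pairs (section_points (H k) (xs ! k) (set (drop (Suc k) xs)))" for k
  have *: "planar_triangles X (xs ! k) (set (drop (Suc k) xs)) = lift_simplex X (xs ! k) ` B' k \<and>
      good_output TYPE('k::field_char_0) 1 (H k) (section_points (H k) (xs ! k) (set (drop (Suc k) xs))) (B' k)"
    if k: "Suc k < length xs" for k
  proof -
    obtain a b where rs: "radial_section (xs ! k) a b (set (drop (Suc k) xs)) (nearest X (xs ! k))"
      and Hk: "H k = {z \<in> A. a \<bullet> z = b}" and dimH: "aff_dim (H k) = aff_dim A - 1"
      and sp: "section_points (H k) (xs ! k) (set (drop (Suc k) xs)) =
         radial_section.pr (xs ! k) a b ` set (drop (Suc k) xs)"
      and ls: "lift_simplex X (xs ! k) = radial_section.lift (xs ! k) (nearest X (xs ! k))"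
      using separating_hyperplane_radial_section[OF plane(5) k plane(1,4) H[OF k]] by blast
    interpret radial_section "xs ! k" a b "set (drop (Suc k) xs)" "nearest X (xs ! k)" by fact
    have "H k = A \<inter> {z. a \<bullet> z = b}" using Hk by auto
    then have "affine (H k)" using plane by (auto intro: affine_Int affine_hyperplane)
    moreover have "section_points (H k) (xs ! k) (set (drop (Suc k) xs)) \<subseteq> H k"
      by (auto simp: section_points_def)
    ultimately have "good_output TYPE('k::field_char_0) 1 (H k) (section_points (H k) (xs ! k) (set (drop (Suc k) xs))) (B' k)"
      unfolding B'_def using dimH plane(2) sp finite_Y by (intro good_output_consecutive_pairs) auto
    moreover have "planar_triangles X (xs ! k) (set (drop (Suc k) xs)) = lift_simplex X (xs ! k) ` B' k"
      unfolding planar_triangles_def neighbouring_rays_triangles B'_def sp ls ..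
    ultimately show ?thesis by simp
  qed
  have "good_output TYPE('k::field_char_0) (Suc 1) A X (\<Union>k\<in>{k. Suc k < length xs}. lift_simplex X (xs ! k) ` B' k)"
    using plane H * by (intro good_output_step) auto
  also have "(\<Union>k\<in>{k. Suc k < length xs}. lift_simplex X (xs ! k) ` B' k) =
      (\<Union>k\<in>{k. Suc k < length xs}. planar_triangles X (xs ! k) (set (drop (Suc k) xs)))"
    using * by auto
  also have "\<dots> = (\<Union>k<length xs. planar_triangles X (xs ! k) (set (drop (Suc k) xs)))"
  proof -
    \<comment> \<open>The last point is followed by no other and spans no rays, so both index ranges
      give the same union.\<close>
    have "planar_triangles X (xs ! k) (set (drop (Suc k) xs)) = {}" if "\<not> Suc k < length xs" for k
      using that by (simp add: planar_triangles_def neighbouring_rays_def)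
    then show ?thesis by fastforce
  qed
  finally show ?case using plane(2) by (simp add: numeral_2_eq_2)
next
  case (higher A X xs H B')
  define d where "d = nat (aff_dim A) - 1"
  have d: "aff_dim A = int (Suc d)" using higher(2) by (simp add: d_def)
  have "good_output TYPE('k::field_char_0) d (H k) (section_points (H k) (xs ! k) (set (drop (Suc k) xs))) (B' k)"
    if "Suc k < length xs" for k
  proof -
    have "aff_dim (H k) = int d"
      using higher(6) that d by (auto simp: separating_hyperplane_def)
    then show ?thesis using higher(7) that by auto
  qed
  then have "good_output TYPE('k::field_char_0) (Suc d) A X (\<Union>k\<in>{k. Suc k < length xs}. lift_simplex X (xs ! k) ` B' k)"
    using higher d by (intro good_output_step) auto
  moreover have "nat (aff_dim A) = Suc d" by (simp only: d nat_int)
  ultimately show ?case by simp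
qed

lemma sum_zero_at:
  assumes "finite S" "g i = 0" "\<And>v. v \<in> S - {i} \<Longrightarrow> g v = h v"
  shows "sum g S = (sum h (S - {i}) :: 'b::comm_monoid_add)"
  using assms by (intro sum.mono_neutral_cong_right) auto

section \<open>Linear relations between rows\<close>

text \<open>An affine dependence \<open>c\<close> of the points of \<open>S\<close>, where
  \<open>S - {s}\<close> is a nondegenerate simplex. Coefficients other than that of
  \<open>s\<close> may vanish, so \<open>S\<close> need not be in general position.\<close>

locale affine_circuit =
  fixes S :: "'a::euclidean_space set" and c :: "'a \<Rightarrow> real" and s :: 'a
  assumes finite_S: "finite S" and card_S: "card S = DIM('a) + 2"
    and sum_c: "sum c S = 0" and sum_cv: "(\<Sum>v\<in>S. c v *\<^sub>R v) = 0"
    and s: "s \<in> S" "c s \<noteq> 0" and independent_s: "\<not> affine_dependent (S - {s})"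
begin

lemma affine_circuit_uminus: "affine_circuit S (\<lambda>v. - c v) s"
  by unfold_locales
    (use finite_S card_S sum_c sum_cv s independent_s in \<open>auto simp: sum_negf\<close>)

text \<open>Subtracting the multiple of \<open>c\<close> that cancels the coefficient at
  \<open>s\<close> leaves a dependence of the independent set \<open>S - {s}\<close>.\<close>

lemma dependence_unique:
  assumes "sum d S = 0" "(\<Sum>v\<in>S. d v *\<^sub>R v) = 0"
  obtains t where "\<And>v. v \<in> S \<Longrightarrow> d v = t * c v"
proof
  let ?t = "d s / c s"
  let ?e = "\<lambda>v. d v - ?t * c v"
  have es: "?e s = 0" using s by simp
  have "sum ?e S = sum d S - ?t * sum c S" by (simp only: sum_subtractf sum_distrib_left)
  then have "sum ?e S = 0" using assms sum_c by simp
  then have 1: "sum ?e (S - {s}) = 0" using es finite_S s by (simp add: sum_diff1)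
  have "(\<Sum>v\<in>S. ?e v *\<^sub>R v) = (\<Sum>v\<in>S. d v *\<^sub>R v) - ?t *\<^sub>R (\<Sum>v\<in>S. c v *\<^sub>R v)"
    by (simp add: scaleR_left_diff_distrib sum_subtractf scaleR_sum_right)
  also have "\<dots> = 0" using assms sum_cv by simp
  finally have 2: "(\<Sum>v\<in>S - {s}. ?e v *\<^sub>R v) = 0" using es finite_S s by (simp add: sum_diff1)
  have "?e v = 0" if "v \<in> S - {s}" for v
    using 1 2 that independent_s finite_S affine_dependent_explicit_finite[of "S - {s}"] by blast
  then show "d v = ?t * c v" if "v \<in> S" for v using es that by (cases "v = s") auto
qed

text \<open>A dependence of \<open>S - {i}\<close>, extended by zero, is a multiple of
  \<open>c\<close>; as it vanishes at \<open>i\<close> while \<open>c\<close> does not, the multiple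
  is zero.\<close>

lemma independent_facet:
  assumes i: "i \<in> S" "c i \<noteq> 0"
  shows "\<not> affine_dependent (S - {i})"
proof
  assume "affine_dependent (S - {i})"
  then obtain d where d: "sum d (S - {i}) = 0" "(\<Sum>v\<in>S - {i}. d v *\<^sub>R v) = 0" "\<exists>v\<in>S - {i}. d v \<noteq> 0"
    using affine_dependent_explicit_finite[of "S - {i}"] finite_S by blast
  let ?d = "\<lambda>v. if v = i then 0 else d v"
  have "sum ?d S = sum d (S - {i})" using finite_S by (rule sum_zero_at) auto
  then have 1: "sum ?d S = 0" using d by simp
  have "(\<Sum>v\<in>S. ?d v *\<^sub>R v) = (\<Sum>v\<in>S - {i}. d v *\<^sub>R v)" using finite_S by (rule sum_zero_at) auto
  then have 2: "(\<Sum>v\<in>S. ?d v *\<^sub>R v) = 0" using d by simp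
  obtain t where t: "\<And>v. v \<in> S \<Longrightarrow> ?d v = t * c v" using dependence_unique[OF 1 2] by blast
  have "t = 0" using t[OF i(1)] i by simp
  then have "d v = 0" if "v \<in> S - {i}" for v using t[of v] that by auto
  then show False using d(3) by blast
qed

lemma facet_full_simplex: "i \<in> S \<Longrightarrow> c i \<noteq> 0 \<Longrightarrow> S - {i} \<in> full_simplices DIM('a) S"
  using independent_facet card_S finite_S by (simp add: full_simplices_def)

text \<open>Caratheodory's argument: a multiple of \<open>c\<close> is subtracted from convex
  coefficients of \<open>p\<close> until one with positive \<open>c\<close> becomes zero.\<close>

lemma covering_positive_facet:
  assumes p: "p \<in> convex hull S"
  obtains i where "i \<in> S" "0 < c i" "p \<in> convex hull (S - {i})"
proof -
  obtain u where u: "\<And>v. v \<in> S \<Longrightarrow> 0 \<le> u v" "sum u S = 1" "(\<Sum>v\<in>S. u v *\<^sub>R v) = p"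
    using p finite_S by (auto simp: convex_hull_finite)
  define P where "P = {v \<in> S. 0 < c v}"
  have finP: "finite P" using finite_S by (simp add: P_def)
  have "P \<noteq> {}"
  proof
    assume "P = {}"
    then have "\<forall>v\<in>S. 0 \<le> - c v" by (auto simp: P_def not_less)
    moreover have "(\<Sum>v\<in>S. - c v) = 0" using sum_c by (simp add: sum_negf)
    ultimately have "\<forall>v\<in>S. - c v = 0" using finite_S by (subst (asm) sum_nonneg_eq_0_iff) auto
    then show False using s by auto
  qed
  \<comment> \<open>The largest multiple of \<open>c\<close> that keeps all coefficients
    nonnegative; the minimum is attained at the vertex to be omitted.\<close>
  define t where "t = Min ((\<lambda>v. u v / c v) ` P)"
  have "t \<in> (\<lambda>v. u v / c v) ` P" unfolding t_def using finP \<open>P \<noteq> {}\<close> by (intro Min_in) auto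
  then obtain i where i: "i \<in> P" "t = u i / c i" by auto
  have tle: "t \<le> u v / c v" if "v \<in> P" for v unfolding t_def using finP that by (intro Min_le) auto
  define w where "w = (\<lambda>v. u v - t * c v)"
  have t0: "0 \<le> t" using i u by (simp add: P_def)
  have w0: "0 \<le> w v" if v: "v \<in> S" for v
  proof (cases "0 < c v")
    case True
    then show ?thesis using tle[of v] v by (simp add: P_def w_def field_simps)
  next
    case False
    then have "t * c v \<le> 0" using t0 by (simp add: mult_nonneg_nonpos)
    then show ?thesis using u(1)[OF v] by (simp add: w_def)
  qed
  have wi: "w i = 0" using i by (simp add: w_def P_def)
  have iS: "i \<in> S" "0 < c i" using i by (auto simp: P_def)
  have "sum w S = sum u S - t * sum c S" by (simp only: w_def sum_subtractf sum_distrib_left)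
  then have "sum w S = 1" using u sum_c by simp
  then have 1: "sum w (S - {i}) = 1" using finite_S iS wi by (simp add: sum_diff1)
  have "(\<Sum>v\<in>S. w v *\<^sub>R v) = (\<Sum>v\<in>S. u v *\<^sub>R v) - t *\<^sub>R (\<Sum>v\<in>S. c v *\<^sub>R v)"
    by (simp add: w_def scaleR_left_diff_distrib sum_subtractf scaleR_sum_right)
  then have "(\<Sum>v\<in>S - {i}. w v *\<^sub>R v) = p" using finite_S iS wi u sum_cv by (simp add: sum_diff1)
  then have "p \<in> convex hull (S - {i})" using 1 w0 finite_S by (auto simp: convex_hull_finite)
  then show ?thesis using that iS by blast
qed

text \<open>The coordinates of \<open>p\<close> in the two facets are positive and differ by a
  multiple \<open>t\<close> of \<open>c\<close>. The difference is positive at \<open>i\<close> and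
  negative at \<open>j\<close>, although \<open>c\<close> is positive at both.\<close>

lemma positive_facet_unique:
  assumes interior: "\<And>i. i \<in> S \<Longrightarrow> c i \<noteq> 0 \<Longrightarrow> p \<notin> frontier (convex hull (S - {i}))"
    and ij: "i \<in> S" "0 < c i" "p \<in> convex hull (S - {i})" "j \<in> S" "0 < c j" "p \<in> convex hull (S - {j})"
  shows "i = j"
proof (rule ccontr)
  assume "i \<noteq> j"
  have coords: "\<exists>u. u k = 0 \<and> (\<forall>v\<in>S - {k}. 0 < u v) \<and> sum u S = 1 \<and> (\<Sum>v\<in>S. u v *\<^sub>R v) = p"
    if k: "k \<in> S" "0 < c k" "p \<in> convex hull (S - {k})" for k
  proof -
    have ind: "\<not> affine_dependent (S - {k})" using independent_facet k by simp
    have cl: "closed (convex hull (S - {k}))"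
      using finite_S by (simp add: finite_imp_compact_convex_hull compact_imp_closed)
    have "p \<in> interior (convex hull (S - {k}))"
      using interior[of k] k cl by (simp add: frontier_def)
    moreover have "\<not> card (S - {k}) \<le> DIM('a)" using card_S finite_S k by simp
    ultimately obtain u where u: "\<forall>v\<in>S - {k}. 0 < u v" "sum u (S - {k}) = 1" "(\<Sum>v\<in>S - {k}. u v *\<^sub>R v) = p"
      using interior_convex_hull_explicit[OF ind] by auto
    let ?u = "\<lambda>v. if v = k then 0 else u v"
    have "sum ?u S = sum u (S - {k})" using finite_S by (rule sum_zero_at) auto
    moreover have "(\<Sum>v\<in>S. ?u v *\<^sub>R v) = (\<Sum>v\<in>S - {k}. u v *\<^sub>R v)"
      using finite_S by (rule sum_zero_at) auto
    ultimately have "sum ?u S = 1" "(\<Sum>v\<in>S. ?u v *\<^sub>R v) = p" using u by simp_all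
    then show ?thesis using u by (intro exI[of _ ?u]) auto
  qed
  obtain u where u: "u i = 0" "\<forall>v\<in>S - {i}. 0 < u v" "sum u S = 1" "(\<Sum>v\<in>S. u v *\<^sub>R v) = p"
    using coords[of i] ij by auto
  obtain w where w: "w j = 0" "\<forall>v\<in>S - {j}. 0 < w v" "sum w S = 1" "(\<Sum>v\<in>S. w v *\<^sub>R v) = p"
    using coords[of j] ij by auto
  have 1: "(\<Sum>v\<in>S. w v - u v) = 0" using u w by (simp add: sum_subtractf)
  have 2: "(\<Sum>v\<in>S. (w v - u v) *\<^sub>R v) = 0" using u w by (simp add: scaleR_left_diff_distrib sum_subtractf)
  obtain t where t: "\<And>v. v \<in> S \<Longrightarrow> w v - u v = t * c v" using dependence_unique[OF 1 2] by metis
  have "0 < w i" "0 < u j" using u w ij \<open>i \<noteq> j\<close> by auto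
  then have "0 < t * c i" "t * c j < 0" using t[OF ij(1)] t[OF ij(4)] u w by auto
  then show False using ij by (simp add: zero_less_mult_iff mult_less_0_iff)
qed

lemma count_positive_facets:
  assumes "\<And>i. i \<in> S \<Longrightarrow> c i \<noteq> 0 \<Longrightarrow> p \<notin> frontier (convex hull (S - {i}))"
  shows "(\<Sum>i\<in>{i \<in> S. 0 < c i}. of_bool (p \<in> convex hull (S - {i}))) =
    (of_bool (p \<in> convex hull S) :: 'k::field_char_0)"
proof (cases "p \<in> convex hull S")
  case True
  obtain i where i: "i \<in> S" "0 < c i" "p \<in> convex hull (S - {i})" using covering_positive_facet[OF True] .
  have "p \<in> convex hull (S - {j}) \<longleftrightarrow> j = i" if "j \<in> S" "0 < c j" for j
    using positive_facet_unique[OF assms] i that by blast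
  then have "(\<Sum>j\<in>{j \<in> S. 0 < c j}. of_bool (p \<in> convex hull (S - {j}))) =
      (\<Sum>j\<in>{j \<in> S. 0 < c j}. if j = i then 1 else 0 :: 'k)"
    by (intro sum.cong) auto
  then show ?thesis using True i finite_S by simp
next
  case False
  then have "p \<notin> convex hull (S - {i})" for i using hull_mono[of "S - {i}" S convex] by blast
  then show ?thesis using False by simp
qed

text \<open>Only signs of the real coefficients enter the relation between rows, so it has a meaning
  over every field \<open>'k\<close>.\<close>

definition facet_sign :: "'a \<Rightarrow> 'k::field_char_0" where
  "facet_sign i = (if 0 < c i then 1 else if c i < 0 then - 1 else 0)"

text \<open>Applied to \<open>c\<close> and to its negative, the count shows that the positive and
  the negative facets both add up to the indicator of the hull of \<open>S\<close>.\<close>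

lemma signed_facet_sum:
  assumes "\<And>i. i \<in> S \<Longrightarrow> c i \<noteq> 0 \<Longrightarrow> p \<notin> frontier (convex hull (S - {i}))"
  shows "(\<Sum>i\<in>S. facet_sign i * of_bool (p \<in> convex hull (S - {i}))) = (0 :: 'k::field_char_0)"
proof -
  interpret neg: affine_circuit S "\<lambda>v. - c v" s by (rule affine_circuit_uminus)
  let ?h = "\<lambda>i. of_bool (p \<in> convex hull (S - {i})) :: 'k"
  have "(\<Sum>i\<in>S. facet_sign i * ?h i) =
      (\<Sum>i\<in>S. (if 0 < c i then ?h i else 0) - (if 0 < - c i then ?h i else 0))"
    by (intro sum.cong) (auto simp: facet_sign_def)
  also have "\<dots> = (\<Sum>i\<in>{i \<in> S. 0 < c i}. ?h i) - (\<Sum>i\<in>{i \<in> S. 0 < - c i}. ?h i)"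
    unfolding sum_subtractf using finite_S by (simp only: sum.inter_filter)
  also have "\<dots> = 0"
    using count_positive_facets[OF assms, where 'k = 'k] neg.count_positive_facets[of p, where 'k = 'k] assms
    by simp
  finally show ?thesis .
qed

end

section \<open>Chambers and the span of the rows\<close>

lemma simplices_eq: "simplices (E :: 'a::euclidean_space set) = full_simplices DIM('a) E"
  by (simp add: simplices_def full_simplices_def)

text \<open>A component is connected and avoids the boundary of the simplex, so one of its points
  inside forces all of it inside. Entries of the incidence matrix can thus be tested at a single
  point.\<close>

lemma component_subset_simplex_iff:
  fixes E :: "'a::euclidean_space set"
  assumes C: "C \<in> components (convex hull E - walls E)" "p \<in> C" and \<sigma>: "\<sigma> \<in> simplices E"
  shows "closure C \<subseteq> convex hull \<sigma> \<longleftrightarrow> p \<in> convex hull \<sigma>"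
proof
  assume "closure C \<subseteq> convex hull \<sigma>"
  then show "p \<in> convex hull \<sigma>" using C closure_subset by blast
next
  assume p: "p \<in> convex hull \<sigma>"
  have "finite \<sigma>" using \<sigma> card.infinite by (force simp: simplices_def)
  then have "closed (convex hull \<sigma>)" by (simp add: finite_imp_compact_convex_hull compact_imp_closed)
  moreover have "C \<inter> frontier (convex hull \<sigma>) = {}"
    using in_components_subset[OF C(1)] \<sigma> by (auto simp: walls_def)
  then have "C \<subseteq> convex hull \<sigma>"
    using connected_Int_frontier[OF in_components_connected[OF C(1)], of "convex hull \<sigma>"] C p by blast
  ultimately show "closure C \<subseteq> convex hull \<sigma>" by (rule closure_minimal[rotated])
qed

lemma incidence_row_eq:
  assumes "C \<in> components (convex hull E - walls E)" "p \<in> C" "\<sigma> \<in> simplices E"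
  shows "incidence_row E \<sigma> (closure C) = of_bool (p \<in> convex hull \<sigma>)"
  using assms component_subset_simplex_iff[OF assms]
  by (auto simp: incidence_row_def incidence_def chambers_def)

lemma sum_fun_apply: "(\<Sum>i\<in>I. f i) x = (\<Sum>i\<in>I. f i x :: 'b::comm_monoid_add)"
  by (induction I rule: infinite_finite_induct) auto

text \<open>The signed facet relation, evaluated at one point of each chamber, is a linear relation
  between rows in which the row of \<open>\<tau>\<close> occurs with coefficient -1.\<close>

lemma exchange_closed_span:
  fixes E :: "'a::euclidean_space set" and R :: "('a set \<Rightarrow> 'k::field_char_0) set"
  shows "exchange_closed DIM('a) E {\<sigma> \<in> simplices E. incidence_row E \<sigma> \<in> row_space.span R}"
    (is "exchange_closed _ _ ?D")
  unfolding exchange_closed_def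
proof (intro allI impI)
  fix S \<tau> assume S: "S \<subseteq> E" "card S = DIM('a) + 2" and \<tau>: "\<tau> \<in> full_simplices DIM('a) S"
    and others: "full_simplices DIM('a) S - {\<tau>} \<subseteq> ?D"
  have finS: "finite S" using S card.infinite by fastforce
  have \<tau>': "\<tau> \<subseteq> S" "card \<tau> = Suc DIM('a)" "\<not> affine_dependent \<tau>"
    using \<tau> by (auto simp: full_simplices_def)
  have fin\<tau>: "finite \<tau>" using \<tau>' finS finite_subset by blast
  have "card (S - \<tau>) = 1" using \<tau>' S fin\<tau> by (simp add: card_Diff_subset)
  then obtain s where "S - \<tau> = {s}" by (auto simp: card_1_singleton_iff)
  then have s_props: "s \<in> S" "s \<notin> \<tau>" "\<tau> = S - {s}" using \<tau>' by auto
  have "affine hull \<tau> = UNIV" using \<tau>' by (intro affine_independent_span_eq) auto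
  then have "s \<in> affine hull \<tau>" by simp
  then obtain u where u: "sum u \<tau> = 1" "(\<Sum>v\<in>\<tau>. u v *\<^sub>R v) = s"
    using fin\<tau> by (auto simp: affine_hull_finite)
  define c where "c v = (if v = s then - 1 else u v)" for v
  have "sum c \<tau> = sum u \<tau>" "(\<Sum>v\<in>\<tau>. c v *\<^sub>R v) = (\<Sum>v\<in>\<tau>. u v *\<^sub>R v)"
    using s_props(2) by (auto simp: c_def intro!: sum.cong)
  then have "sum c S = 0" "(\<Sum>v\<in>S. c v *\<^sub>R v) = 0"
    using u sum.remove[OF finS s_props(1), of c] sum.remove[OF finS s_props(1), of "\<lambda>v. c v *\<^sub>R v"]
    by (simp_all add: c_def flip: s_props(3))
  then interpret affine_circuit S c s
    using finS S s_props \<tau>' by unfold_locales (auto simp: c_def)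
  have facet: "S - {i} \<in> simplices E" if "i \<in> S" "c i \<noteq> 0" for i
    using facet_full_simplex[OF that] full_simplices_mono[OF S(1)] by (auto simp: simplices_eq)
  have zero: "(\<Sum>i\<in>S. facet_sign i * (incidence_row E (S - {i}) \<gamma> :: 'k)) = 0" for \<gamma>
  proof (cases "\<gamma> \<in> chambers E")
    case False
    then show ?thesis by (simp add: incidence_row_def)
  next
    case True
    then obtain C where C: "C \<in> components (convex hull E - walls E)" "\<gamma> = closure C"
      by (auto simp: chambers_def)
    then obtain p where p: "p \<in> C" using in_components_nonempty by blast
    have "p \<notin> walls E" using in_components_subset[OF C(1)] p by auto
    then have "p \<notin> frontier (convex hull (S - {i}))" if "i \<in> S" "c i \<noteq> 0" for i
      using facet[OF that] by (auto simp: walls_def)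
    then have "(\<Sum>i\<in>S. facet_sign i * of_bool (p \<in> convex hull (S - {i}))) = (0 :: 'k)"
      by (rule signed_facet_sum)
    \<comment> \<open>Where \<open>c i = 0\<close> the set \<open>S - {i}\<close> may fail to be a
      simplex, but its sign is zero.\<close>
    moreover have eq: "facet_sign i * incidence_row E (S - {i}) \<gamma> = facet_sign i * (of_bool (p \<in> convex hull (S - {i})) :: 'k)"
      if "i \<in> S" for i
      using incidence_row_eq[OF C(1) p facet[OF that]] C by (cases "c i = 0") (simp_all add: facet_sign_def)
    ultimately show ?thesis by (simp only: sum.cong[OF refl eq])
  qed
  have "incidence_row E \<tau> = (\<Sum>i\<in>\<tau>. row_scale (facet_sign i) (incidence_row E (S - {i}) :: 'a set \<Rightarrow> 'k))"
  proof
    fix \<gamma>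
    have "(0 :: 'k) = facet_sign s * incidence_row E \<tau> \<gamma> + (\<Sum>i\<in>\<tau>. facet_sign i * incidence_row E (S - {i}) \<gamma>)"
    proof -
      have "(\<Sum>i\<in>S. facet_sign i * (incidence_row E (S - {i}) \<gamma> :: 'k)) =
          facet_sign s * incidence_row E (S - {s}) \<gamma> + (\<Sum>i\<in>S - {s}. facet_sign i * incidence_row E (S - {i}) \<gamma>)"
        by (rule sum.remove[OF finS s_props(1)])
      then show ?thesis using zero[of \<gamma>] s_props(3) by simp
    qed
    then show "incidence_row E \<tau> \<gamma> = (\<Sum>i\<in>\<tau>. row_scale (facet_sign i) (incidence_row E (S - {i}) :: 'a set \<Rightarrow> 'k)) \<gamma>"
      by (simp add: sum_fun_apply row_scale_def facet_sign_def c_def)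
  qed
  also have "\<dots> \<in> row_space.span R"
  proof (rule row_space.span_sum)
    fix i assume i: "i \<in> \<tau>"
    show "row_scale (facet_sign i) (incidence_row E (S - {i}) :: 'a set \<Rightarrow> 'k) \<in> row_space.span R"
    proof (cases "c i = 0")
      case True
      then have "row_scale (facet_sign i) (incidence_row E (S - {i}) :: 'a set \<Rightarrow> 'k) = 0"
        by (simp add: facet_sign_def row_scale_def fun_eq_iff)
      then show ?thesis using row_space.span_zero by metis
    next
      case False
      have "S - {i} \<noteq> \<tau>" using i by auto
      then have "S - {i} \<in> ?D" using others facet_full_simplex[of i] False i s_props by blast
      then show ?thesis by (auto intro: row_space.span_scale)
    qed
  qed
  finally show "\<tau> \<in> ?D" using \<tau> full_simplices_mono[OF S(1)] by (auto simp: simplices_eq)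
qed

section \<open>Linear independence of the rows and the basis property\<close>

lemma walls_subset_facets:
  fixes E :: "'a::euclidean_space set"
  shows "walls E \<subseteq> \<Union>{affine hull (\<sigma> - {v}) | \<sigma> v. \<sigma> \<in> simplices E \<and> v \<in> \<sigma>}"
proof
  fix p assume "p \<in> walls E"
  then obtain \<sigma> where \<sigma>: "\<sigma> \<in> simplices E" "p \<in> frontier (convex hull \<sigma>)" by (auto simp: walls_def)
  then have "\<not> affine_dependent \<sigma>" "\<not> card \<sigma> \<le> DIM('a)" by (auto simp: simplices_def)
  then obtain v where "v \<in> \<sigma>" "p \<in> convex hull (\<sigma> - {v})"
    using \<sigma>(2) frontier_convex_hull_cases[of \<sigma>] by auto
  then show "p \<in> \<Union>{affine hull (\<sigma> - {v}) | \<sigma> v. \<sigma> \<in> simplices E \<and> v \<in> \<sigma>}"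
    using \<sigma>(1) convex_hull_subset_affine_hull by blast
qed

text \<open>A point off the hyperplanes spanned by facets lies in a component or outside the hull of
  \<open>E\<close>. In the first case the relation between rows at the closure of the component is
  the relation between indicators at the point; in the second all indicators vanish.\<close>

lemma rows_independent_family:
  fixes E :: "'a::euclidean_space set" and \<beta> :: "'a set \<Rightarrow> 'k::field_char_0"
  assumes E: "finite E" and B: "B \<subseteq> simplices E" "generically_independent TYPE('k) UNIV B"
    and zero: "(\<Sum>\<sigma>\<in>B. row_scale (\<beta> \<sigma>) (incidence_row E \<sigma>)) = 0" and \<sigma>: "\<sigma> \<in> B"
  shows "\<beta> \<sigma> = 0"
proof (rule generically_independentD[OF B(2), where \<beta> = \<beta>])
  let ?\<F> = "{affine hull (\<sigma> - {v}) | \<sigma> v. \<sigma> \<in> simplices E \<and> v \<in> \<sigma>}"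
  have "finite (simplices E)" using finite_full_simplices[OF E] by (simp add: simplices_eq)
  moreover have fin: "finite \<sigma>" if "\<sigma> \<in> simplices E" for \<sigma>
    using that E finite_subset by (auto simp: simplices_def)
  moreover have "?\<F> = (\<Union>\<sigma>\<in>simplices E. (\<lambda>v. affine hull (\<sigma> - {v})) ` \<sigma>)" by auto
  ultimately show "finite ?\<F>" by simp
  show "affine F \<and> \<not> UNIV \<subseteq> F" if F: "F \<in> ?\<F>" for F
  proof -
    obtain \<sigma> v where v: "F = affine hull (\<sigma> - {v})" "\<sigma> \<in> simplices E" "v \<in> \<sigma>" using F by auto
    have "finite \<sigma>" using fin v(2) .
    moreover have "card \<sigma> = DIM('a) + 1" using v(2) by (simp add: simplices_def)
    ultimately have "card (\<sigma> - {v}) = DIM('a)" using v(3) by simp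
    then have "aff_dim F < int (DIM('a))"
      using v(1) \<open>finite \<sigma>\<close> aff_dim_le_card[of "\<sigma> - {v}"] by simp
    then have "F \<noteq> UNIV" by auto
    then show ?thesis using v by auto
  qed
  show "(\<Sum>\<sigma>\<in>B. \<beta> \<sigma> * of_bool (p \<in> convex hull \<sigma>)) = 0" if p: "p \<notin> \<Union>?\<F>" for p
  proof (cases "p \<in> convex hull E")
    case True
    then have "p \<in> convex hull E - walls E" using p walls_subset_facets[of E] by blast
    then obtain C where C: "C \<in> components (convex hull E - walls E)" "p \<in> C"
      by (metis UnionE Union_components)
    have "0 = (\<Sum>\<sigma>\<in>B. row_scale (\<beta> \<sigma>) (incidence_row E \<sigma>)) (closure C)" using zero by simp
    also have "\<dots> = (\<Sum>\<sigma>\<in>B. \<beta> \<sigma> * of_bool (p \<in> convex hull \<sigma>))"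
      unfolding sum_fun_apply row_scale_def
      by (intro sum.cong refl) (simp add: incidence_row_eq[OF C subsetD[OF B(1)]])
    finally show ?thesis by simp
  next
    case False
    have "p \<notin> convex hull \<sigma>" if "\<sigma> \<in> B" for \<sigma>
      using False that B(1) hull_mono[of \<sigma> E convex] by (auto simp: simplices_def)
    then show ?thesis by (intro sum.neutral) auto
  qed
qed (rule \<sigma>)

lemma basis_of_good_output:
  fixes E :: "'a::euclidean_space set"
  assumes E: "finite E" and B: "good_output TYPE('k::field_char_0) DIM('a) UNIV E B"
  shows "basis_in_V_Sigma TYPE('k) E B"
proof -
  let ?r = "incidence_row E :: 'a set \<Rightarrow> 'a set \<Rightarrow> 'k"
  have sub: "B \<subseteq> simplices E" and gen: "generates DIM('a) E B"
    and ind: "generically_independent TYPE('k) UNIV B"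
    using B by (auto simp: good_output_def simplices_eq)
  have finB: "finite B"
    using finite_subset[OF sub] finite_full_simplices[OF E] by (simp add: simplices_eq)
  note family = rows_independent_family[OF E sub ind]
  have inj: "inj_on ?r B"
  proof (rule inj_onI, rule ccontr)
    fix \<sigma> \<tau> assume *: "\<sigma> \<in> B" "\<tau> \<in> B" "?r \<sigma> = ?r \<tau>" "\<sigma> \<noteq> \<tau>"
    \<comment> \<open>Two equal rows would be a nontrivial relation within the family indexed by
      \<open>B\<close>, so injectivity follows from the same independence result.\<close>
    define \<beta> where "\<beta> \<rho> = (if \<rho> = \<sigma> then 1 else if \<rho> = \<tau> then - 1 else 0 :: 'k)" for \<rho>
    have "(\<Sum>\<rho>\<in>B. row_scale (\<beta> \<rho>) (?r \<rho>)) = (\<Sum>\<rho>\<in>{\<sigma>, \<tau>}. row_scale (\<beta> \<rho>) (?r \<rho>))"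
      using * finB by (intro sum.mono_neutral_right) (auto simp: \<beta>_def row_scale_def fun_eq_iff)
    also have "\<dots> = 0" using * by (simp add: \<beta>_def row_scale_def fun_eq_iff)
    finally have "\<beta> \<sigma> = 0" using family * by blast
    then show False by (simp add: \<beta>_def)
  qed
  have "row_space.independent (?r ` B)"
  proof
    assume "row_space.dependent (?r ` B)"
    then obtain u where u: "\<exists>v\<in>?r ` B. u v \<noteq> 0" "(\<Sum>v\<in>?r ` B. row_scale (u v) v) = 0"
      using row_space.dependent_finite[of "?r ` B"] finB by auto
    have "(\<Sum>\<sigma>\<in>B. row_scale (u (?r \<sigma>)) (?r \<sigma>)) = 0"
      using u(2) inj by (simp add: sum.reindex)
    then have "u (?r \<sigma>) = 0" if "\<sigma> \<in> B" for \<sigma> using family[of "\<lambda>\<sigma>. u (?r \<sigma>)"] that by blast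
    then show False using u(1) by auto
  qed
  moreover have "row_space.span (?r ` B) = V_Sigma E"
  proof -
    \<comment> \<open>The simplices whose row lies in the span of the rows of \<open>B\<close> form
      an exchange-closed set containing \<open>B\<close>, hence comprise all simplices.\<close>
    have "B \<subseteq> {\<sigma> \<in> simplices E. ?r \<sigma> \<in> row_space.span (?r ` B)}"
      using sub by (auto intro: row_space.span_base)
    then have "simplices E \<subseteq> {\<sigma> \<in> simplices E. ?r \<sigma> \<in> row_space.span (?r ` B)}"
      using gen exchange_closed_span[of E "?r ` B"] unfolding generates_def simplices_eq by blast
    then have "?r ` simplices E \<subseteq> row_space.span (?r ` B)" by blast
    then have "row_space.span (?r ` simplices E) \<subseteq> row_space.span (?r ` B)"
      by (simp add: row_space.span_minimal)
    moreover have "row_space.span (?r ` B) \<subseteq> row_space.span (?r ` simplices E)"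
      using sub by (intro row_space.span_mono image_mono)
    ultimately show ?thesis by (simp add: V_Sigma_def)
  qed
  ultimately show ?thesis using sub inj by (simp add: basis_in_V_Sigma_def)
qed

section \<open>From closure to finite sequences of steps\<close>

text \<open>The entries of a valid sequence are distinct, so there is one of maximal length. Since
  it cannot be prolonged, its entries together with \<open>B\<close> are exchange closed and exhaust
  all simplices.\<close>

lemma expressed_in_steps_of_generates:
  fixes E :: "'a::euclidean_space set"
  assumes E: "finite E" and gen: "generates DIM('a) E B" and \<sigma>: "\<sigma> \<in> simplices E" "\<sigma> \<notin> B"
  shows "\<exists>k. expressed_in_steps (simplices E) (system_F E) k B \<sigma>"
proof -
  define valid where "valid ss \<longleftrightarrow> set ss \<subseteq> simplices E \<and>
      (\<forall>i<length ss. expressed_one_step (system_F E) (B \<union> set (take i ss)) (ss ! i))" for ss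
  have bound: "length ss \<le> card (simplices E)" if ss: "valid ss" for ss
  proof -
    have "ss ! i \<noteq> ss ! j" if "i < j" "j < length ss" for i j
    proof -
      have "ss ! j \<notin> set (take j ss)" using ss that by (auto simp: valid_def expressed_one_step_def)
      moreover have "ss ! i \<in> set (take j ss)" using that by (auto simp: in_set_conv_nth)
      ultimately show ?thesis by metis
    qed
    then have "distinct ss" unfolding distinct_conv_nth by (metis linorder_neqE_nat)
    then show ?thesis
      using ss finite_full_simplices[OF E] distinct_card[of ss] card_mono[of "simplices E" "set ss"]
      by (simp add: valid_def simplices_eq)
  qed
  have "valid []" by (simp add: valid_def)
  then have "\<exists>ss. valid ss \<and> (\<forall>ts. valid ts \<longrightarrow> length ts \<le> length ss)"
    by (rule ex_has_greatest_nat[where b = "Suc (card (simplices E))"]) (simp add: bound le_imp_less_Suc)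
  then obtain ss where ss: "valid ss" and max: "\<And>ts. valid ts \<Longrightarrow> length ts \<le> length ss"
    by blast
  have "exchange_closed DIM('a) E (B \<union> set ss)"
    unfolding exchange_closed_def
  proof (intro allI impI, rule ccontr)
    fix S \<tau> assume S: "S \<subseteq> E" "card S = DIM('a) + 2" and \<tau>: "\<tau> \<in> full_simplices DIM('a) S"
      and others: "full_simplices DIM('a) S - {\<tau>} \<subseteq> B \<union> set ss" and n: "\<tau> \<notin> B \<union> set ss"
    have f: "full_simplices DIM('a) S = {\<sigma> \<in> simplices E. \<sigma> \<subseteq> S}"
      using S by (auto simp: simplices_eq full_simplices_def)
    have T: "\<exists>T\<subseteq>S. card T = DIM('a) + 1 \<and> \<not> affine_dependent T"
      using \<tau> by (auto simp: full_simplices_def)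
    have "full_simplices DIM('a) S \<in> system_F E"
      unfolding system_F_def f by (rule CollectI, rule exI[of _ S]) (simp only: S T simp_thms)
    then have "expressed_one_step (system_F E) (B \<union> set ss) \<tau>"
      unfolding expressed_one_step_def using n \<tau> others by blast
    then have "valid (ss @ [\<tau>])"
      using ss \<tau> f by (auto simp: valid_def nth_append less_Suc_eq)
    then show False using max by fastforce
  qed
  then have "simplices E \<subseteq> B \<union> set ss" using gen unfolding generates_def simplices_eq by blast
  then have "\<sigma> \<in> set ss" using \<sigma> by blast
  then obtain i where i: "i < length ss" "ss ! i = \<sigma>" by (auto simp: in_set_conv_nth)
  \<comment> \<open>Indices start at 0, so the sequence cut off right after \<open>\<sigma>\<close>
    has \<open>Suc i\<close> steps.\<close>
  have "expressed_in_steps (simplices E) (system_F E) (Suc i) B \<sigma>"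
    unfolding expressed_in_steps_def
  proof (intro conjI exI[of _ "take (Suc i) ss"] allI impI)
    show "length (take (Suc i) ss) = Suc i" using i by simp
    show "take (Suc i) ss \<noteq> []" using i by auto
    show "set (take (Suc i) ss) \<subseteq> simplices E"
      using ss set_take_subset[of "Suc i" ss] by (auto simp: valid_def)
    show "last (take (Suc i) ss) = \<sigma>" using i by (simp add: take_Suc_conv_app_nth)
    fix j assume "j < Suc i"
    then show "expressed_one_step (system_F E) (B \<union> set (take j (take (Suc i) ss))) (take (Suc i) ss ! j)"
      using ss i by (simp add: valid_def min_def)
  qed (rule \<sigma>)
  then show ?thesis ..
qed

theorem theorem4p5:
  fixes E :: "'a::euclidean_space set" and B :: "'a set set" and n :: nat
  assumes "DIM('a) = n" and "n \<ge> 2"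
    and "finite E" and "card E > n"
    and "algorithm_output (UNIV :: 'a set) E B"
  shows "geometrical_basis TYPE('k::field_char_0) E (system_F E) B"
proof -
  have good: "good_output TYPE('k) DIM('a) UNIV E B"
    using algorithm_output_good[OF assms(5), where 'k = 'k] by simp
  then have "B \<subseteq> simplices E" "generates DIM('a) E B" by (auto simp: good_output_def simplices_eq)
  then show ?thesis
    using basis_of_good_output[OF assms(3) good] expressed_in_steps_of_generates[OF assms(3)]
    unfolding geometrical_basis_def by blast
qed

end
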